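(* There are constants $C_1, C_2 > 0$ such that the following holds for every integer $\Delta$. Every graph of maximum degree $\Delta$ has local boxicity at most $C_1\Delta$, while almost all graphs of maximum degree $\Delta$ have local boxicity at least $C_2\Delta$.
   Context: All graphs are finite and simple. A real interval is either a bounded interval of $\mathbb{R}$ or $\mathbb{R}$ itself. For an integer $d'\ge 1$, a $d'$-box is a Cartesian product $I_1\times\cdots\times I_{d'}$ of real intervals; it is local in dimension $i$ if $I_i$ is bounded. A $d$-local box in dimension $d'\ge d$ is a $d'$-box that is local in at most $d$ dimensions. The local boxicity $\mathrm{lbox}(G)$ of a graph $G$ is the minimum integer $d$ such that, for some $d'$, there are $d$-local boxes $(B_v)_{v\in V(G)}$ in dimension $d'$ such that two distinct vertices $u,v$ are adjacent in $G$ if and only if $B_u\cap B_v\neq\emptyset$. "Almost all graphs of a class $\mathcal{C}$ satisfy property $P$" means that the proportion of $n$-vertex graphs of $\mathcal{C}$ satisfying $P$ among all $n$-vertex graphs of $\mathcal{C}$ tends to $1$ as $n\to\infty$.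
   Formalization: The upper bound is stated only for Δ ≥ 1, since for Δ = 0 it fails: two isolated vertices have maximum degree 0 but positive local boxicity; Δ ranges over nonnegative integers, and finite graphs are taken with natural-number vertices. *)

theory Defs
  imports "HOL-Analysis.Analysis"
begin

section \<open>Finite simple graphs\<close>

definition simple_graph :: "'a set \<Rightarrow> 'a set set \<Rightarrow> bool" where
  "simple_graph V E \<longleftrightarrow> finite V \<and> (\<forall>e\<in>E. e \<subseteq> V \<and> card e = 2)"

definition degree :: "'a set set \<Rightarrow> 'a \<Rightarrow> nat" where
  "degree E v = card {e \<in> E. v \<in> e}"

text \<open>The \<open>insert 0\<close> only serves to give the graph without vertices maximum degree 0.\<close>

definition max_degree :: "'a set \<Rightarrow> 'a set set \<Rightarrow> nat" where
  "max_degree V E = Max (insert 0 (degree E ` V))"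

text \<open>The class \<open>C\<close> and the property \<open>P\<close> are predicates on graphs; the \<open>n\<close>-vertex graphs
  are the labelled graphs on the vertex set \<open>{..<n}\<close>.\<close>

definition labelled_graphs :: "nat \<Rightarrow> (nat set \<Rightarrow> nat set set \<Rightarrow> bool) \<Rightarrow> nat set set set" where
  "labelled_graphs n C = {E. simple_graph {..<n} E \<and> C {..<n} E}"

definition almost_all ::
  "(nat set \<Rightarrow> nat set set \<Rightarrow> bool) \<Rightarrow> (nat set \<Rightarrow> nat set set \<Rightarrow> bool) \<Rightarrow> bool" where
  "almost_all C P \<longleftrightarrow>
     (\<lambda>n. real (card {E \<in> labelled_graphs n C. P {..<n} E}) / real (card (labelled_graphs n C)))
       \<longlonglongrightarrow> 1"


section \<open>Local boxicity\<close>

text \<open>Intervals are nonempty; bounded ones may be open, closed, half-open or a single point.\<close>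

definition real_interval :: "real set \<Rightarrow> bool" where
  "real_interval I \<longleftrightarrow> I \<noteq> {} \<and> is_interval I \<and> (bounded I \<or> I = UNIV)"

text \<open>Points of \<open>d'\<close>-dimensional space are functions on \<open>{1..d'}\<close>, extended by
  \<open>undefined\<close> as usual for \<open>PiE\<close>.\<close>

definition local_box :: "nat \<Rightarrow> nat \<Rightarrow> (nat \<Rightarrow> real) set \<Rightarrow> bool" where
  "local_box d d' B \<longleftrightarrow> 1 \<le> d' \<and> d \<le> d' \<and>
     (\<exists>I. (\<forall>i\<in>{1..d'}. real_interval (I i)) \<and> B = (\<Pi>\<^sub>E i\<in>{1..d'}. I i) \<and>
          card {i \<in> {1..d'}. bounded (I i)} \<le> d)"

definition local_box_rep ::
  "nat \<Rightarrow> nat \<Rightarrow> 'a set \<Rightarrow> 'a set set \<Rightarrow> ('a \<Rightarrow> (nat \<Rightarrow> real) set) \<Rightarrow> bool" where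
  "local_box_rep d d' V E B \<longleftrightarrow>
     (\<forall>v\<in>V. local_box d d' (B v)) \<and>
     (\<forall>u\<in>V. \<forall>v\<in>V. u \<noteq> v \<longrightarrow> ({u, v} \<in> E \<longleftrightarrow> B u \<inter> B v \<noteq> {}))"

definition lbox :: "'a set \<Rightarrow> 'a set set \<Rightarrow> nat" where
  "lbox V E = (LEAST d. \<exists>d' B. local_box_rep d d' V E B)"

text \<open>The minimum exists: use one dimension per vertex \<open>w\<close>, in which \<open>w\<close> gets \<open>{0}\<close>, its
  neighbours get \<open>{0..1}\<close>, and all other vertices get \<open>{1}\<close>.\<close>

lemma local_box_rep_exists:
  assumes "simple_graph V E"
  shows "\<exists>d d' B. local_box_rep d d' V E B"
proof (cases "V = {}")
  case True
  then show ?thesis by (auto simp: local_box_rep_def)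
next
  case False
  have fin: "finite V" using assms by (simp add: simple_graph_def)
  define n where "n = card V"
  have n1: "1 \<le> n" using False fin by (simp add: n_def Suc_leI card_gt_0_iff)
  obtain g where g: "bij_betw g {1..n} V"
    using ex_bij_betw_nat_finite_1[OF fin] n_def by blast
  define I :: "'a \<Rightarrow> nat \<Rightarrow> real set" where
    "I v i = (if v = g i then {0} else if {v, g i} \<in> E then {0..1} else {1})" for v i
  define B where "B v = (\<Pi>\<^sub>E i\<in>{1..n}. I v i)" for v
  have int: "real_interval (I v i)" for v i
    using is_interval_cc[of "0::real" 0] is_interval_cc[of "1::real" 1]
    by (auto simp: I_def real_interval_def)
  have box: "local_box n n (B v)" for v
  proof -
    have "card {i \<in> {1..n}. bounded (I v i)} \<le> card {1..n}"
      by (rule card_mono) auto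
    then show ?thesis unfolding local_box_def B_def using n1 int by auto
  qed
  have adj: "{u, v} \<in> E \<longleftrightarrow> B u \<inter> B v \<noteq> {}" if "u \<in> V" "v \<in> V" "u \<noteq> v" for u v
  proof
    assume e: "{u, v} \<in> E"
    then have "{v, u} \<in> E" by (simp add: insert_commute)
    with e that(3) have "I u i \<inter> I v i \<noteq> {}" for i
      by (auto simp: I_def)
    then have "(\<Pi>\<^sub>E i\<in>{1..n}. I u i \<inter> I v i) \<noteq> {}"
      by (simp add: PiE_eq_empty_iff)
    then show "B u \<inter> B v \<noteq> {}" by (simp add: B_def PiE_Int)
  next
    assume "B u \<inter> B v \<noteq> {}"
    then obtain x where x: "x \<in> B u" "x \<in> B v" by auto
    obtain i where i: "i \<in> {1..n}" "g i = u"
      using \<open>u \<in> V\<close> bij_betw_imp_surj_on[OF g] by blast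
    have "x i \<in> I u i" "x i \<in> I v i" using x i by (auto simp: B_def)
    then show "{u, v} \<in> E"
      using i that(3) by (auto simp: I_def insert_commute[of v u] split: if_splits)
  qed
  from box adj have "local_box_rep n n V E B" by (auto simp: local_box_rep_def)
  then show ?thesis by blast
qed

lemma lbox_attained:
  assumes "simple_graph V E"
  obtains d' B where "local_box_rep (lbox V E) d' V E B"
  using LeastI_ex[OF local_box_rep_exists[OF assms]] that unfolding lbox_def by blast

lemma lbox_le: "local_box_rep d d' V E B \<Longrightarrow> lbox V E \<le> d"
  unfolding lbox_def by (rule Least_le) blast

text \<open>Edgeless graphs with two vertices have maximum degree 0 but positive local boxicity: a
  0-local box is the whole space.\<close>

lemma max_degree_no_edges: "max_degree {0, 1 :: nat} {} = 0"
  by (simp add: max_degree_def degree_def)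

lemma lbox_no_edges: "lbox {0, 1 :: nat} {} > 0"
proof (rule ccontr)
  assume "\<not> lbox {0, 1 :: nat} {} > 0"
  then have z: "lbox {0, 1 :: nat} {} = 0" by simp
  have "simple_graph {0, 1 :: nat} {}" by (simp add: simple_graph_def)
  then obtain d' B where r: "local_box_rep 0 d' {0, 1 :: nat} {} B"
    using z lbox_attained[of "{0, 1 :: nat}" "{}"] by auto
  have "B v = (\<Pi>\<^sub>E i\<in>{1..d'}. UNIV)" if "v \<in> {0, 1}" for v
  proof -
    have "local_box 0 d' (B v)" using r that unfolding local_box_rep_def by blast
    then obtain I where "\<forall>i\<in>{1..d'}. real_interval (I i)" and B: "B v = (\<Pi>\<^sub>E i\<in>{1..d'}. I i)"
      and "card {i \<in> {1..d'}. bounded (I i)} \<le> 0"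
      unfolding local_box_def by blast
    then have U: "I i = UNIV" if "i \<in> {1..d'}" for i
      using that by (auto simp: real_interval_def)
    have "(\<Pi>\<^sub>E i\<in>{1..d'}. I i) = (\<Pi>\<^sub>E i\<in>{1..d'}. UNIV)"
      by (rule PiE_cong) (rule U)
    with B show ?thesis by simp
  qed
  then have "B 0 \<inter> B 1 \<noteq> {}" by (simp add: PiE_eq_empty_iff)
  with r show False by (auto simp: local_box_rep_def)
qed

end

(*
Upper bound: split both sides of a bipartite pair (A, B) into two halves by the Lovasz local lemma
and a Chernoff bound, so that degrees drop from x to x/2 + x^(2/3). Every vertex takes part in two
of the four resulting pairs, so the number t(x) of bounded intervals per vertex that suffices to
separate the non-edges satisfies t(x) <= 2 t(x/2 + x^(2/3)). The errors sum to a constant factor,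
so t(x) = O(x), starting from a quadratic bound (by distance-two colourings) for bounded x.

Lower bound: a graph on n vertices is determined by the d n bounded intervals of a d-local
representation, each given by its dimension and two ranks, so there are at most n^(4 d n) graphs of local boxicity at
most d. Perfect matchings between blocks give at least n^(D n / 8) graphs of maximum degree D.
*)
theory Submission
  imports Defs "HOL-Combinatorics.Permutations" "HOL-Real_Asymp.Real_Asymp"
begin

section \<open>The local lemma and balanced splittings\<close>

text \<open>The halving pays because the cost is local: \<open>UNIV\<close> is free, so a vertex is
  charged only in the pairs that contain it. If all four pairs were charged, the recursion would
  give order x^2 instead. The two sides of a pair may overlap (the whole graph is the pair of
  \<open>V\<close> with itself), so separators must tolerate arbitrary edges inside a side. The
  bound must not depend on the number of vertices, which rules out a union bound over all
  neighbourhoods. The local lemma works instead: a deviation of x^(2/3) fails with probability at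
  most exp(-x^(1/3)) per half, while each event depends on at most 2 x^2 events. In the lower bound
  both counts are powers of n, with exponents 4 d n and D n / 8. Graphs of local boxicity at most d
  are therefore negligible for d below D / 32; the constant 1/64 leaves half of the exponent as
  slack.\<close>

lemma card_Pow_split:
  assumes "finite V" "X \<subseteq> V"
  shows "card {F \<in> Pow V. P (F \<inter> X) \<and> Q (F - X)} = card {F \<in> Pow X. P F} * card {F \<in> Pow (V - X). Q F}"
proof -
  have "bij_betw (\<lambda>F. (F \<inter> X, F - X)) {F \<in> Pow V. P (F \<inter> X) \<and> Q (F - X)}
          ({F \<in> Pow X. P F} \<times> {F \<in> Pow (V - X). Q F})"
  proof (rule bij_betw_byWitness[where f' = "\<lambda>(F, G). F \<union> G"])
    show "\<forall>a\<in>{F \<in> Pow V. P (F \<inter> X) \<and> Q (F - X)}. (case (a \<inter> X, a - X) of (F, G) \<Rightarrow> F \<union> G) = a"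
      by auto
    have *: "F \<subseteq> X \<Longrightarrow> G \<subseteq> V - X \<Longrightarrow> (F \<union> G) \<inter> X = F \<and> (F \<union> G) - X = G" for F G
      by auto
    then show "\<forall>a'\<in>{F \<in> Pow X. P F} \<times> {F \<in> Pow (V - X). Q F}.
       ((case a' of (F, G) \<Rightarrow> F \<union> G) \<inter> X, (case a' of (F, G) \<Rightarrow> F \<union> G) - X) = a'"
      by auto
    show "(\<lambda>F. (F \<inter> X, F - X)) ` {F \<in> Pow V. P (F \<inter> X) \<and> Q (F - X)}
      \<subseteq> {F \<in> Pow X. P F} \<times> {F \<in> Pow (V - X). Q F}"
      by auto
    show "(\<lambda>(F, G). F \<union> G) ` ({F \<in> Pow X. P F} \<times> {F \<in> Pow (V - X). Q F})
      \<subseteq> {F \<in> Pow V. P (F \<inter> X) \<and> Q (F - X)}"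
      using * assms(2) by auto
  qed
  from bij_betw_same_card[OF this] show ?thesis by (simp add: card_cartesian_product)
qed

text \<open>The uniform probability space is \<open>Pow V\<close>; the event \<open>bad j\<close> depends on the elements of \<open>X j\<close> only.\<close>

theorem lovasz_local_lemma:
  fixes bad :: "'j \<Rightarrow> 'a set \<Rightarrow> bool" and X :: "'j \<Rightarrow> 'a set" and p :: real
  assumes V: "finite V" and J: "finite J" and XV: "\<And>j. j \<in> J \<Longrightarrow> X j \<subseteq> V"
    and loc: "\<And>j F. j \<in> J \<Longrightarrow> bad j F \<longleftrightarrow> bad j (F \<inter> X j)"
    and p: "\<And>j. j \<in> J \<Longrightarrow> real (card {F \<in> Pow (X j). bad j F}) \<le> p * 2 ^ card (X j)"
    and d: "\<And>j. j \<in> J \<Longrightarrow> real (card {k \<in> J. X k \<inter> X j \<noteq> {}}) \<le> d"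
    and pd: "0 \<le> p" "2 * p < 1" "4 * p * d \<le> 1"
  obtains F where "F \<subseteq> V" "\<And>j. j \<in> J \<Longrightarrow> \<not> bad j F"
proof -
  \<comment> \<open>Divided by \<open>2 ^ card V\<close> these are the probabilities that no event
    of \<open>S\<close> occurs, and that \<open>bad j\<close> occurs in addition. Counts avoid
    conditioning on events not yet known to be possible.\<close>
  define N where "N S = real (card {F \<in> Pow V. \<forall>s\<in>S. \<not> bad s F})" for S
  define M where "M j S = real (card {F \<in> Pow V. bad j F \<and> (\<forall>s\<in>S. \<not> bad s F)})" for j S
  have N0: "N S \<ge> 0" for S by (simp add: N_def)
  \<comment> \<open>Independence: inside and outside \<open>X j\<close> the set \<open>F\<close> can
    be chosen freely, so both counts contain the same factor \<open>c\<close> for the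
    outside.\<close>
  have indep: "M j S \<le> p * N S" if j: "j \<in> J" and S: "S \<subseteq> J" and dis: "\<And>s. s \<in> S \<Longrightarrow> X s \<inter> X j = {}" for j S
  proof -
    have avoid: "(\<forall>s\<in>S. \<not> bad s F) \<longleftrightarrow> (\<forall>s\<in>S. \<not> bad s (F - X j))" for F
    proof -
      have "bad s F \<longleftrightarrow> bad s (F - X j)" if "s \<in> S" for s
      proof -
        have "F \<inter> X s = (F - X j) \<inter> X s" using dis[OF that] by auto
        then show ?thesis using loc[of s F] loc[of s "F - X j"] S that by auto
      qed
      then show ?thesis by auto
    qed
    define c where "c = card {F \<in> Pow (V - X j). \<forall>s\<in>S. \<not> bad s F}"
    have "{F \<in> Pow V. bad j F \<and> (\<forall>s\<in>S. \<not> bad s F)}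
        = {F \<in> Pow V. bad j (F \<inter> X j) \<and> (\<forall>s\<in>S. \<not> bad s (F - X j))}"
      using avoid loc[OF j] by blast
    then have 1: "M j S = real (card {F \<in> Pow (X j). bad j F}) * real c"
      unfolding M_def c_def using card_Pow_split[OF V XV[OF j], of "bad j" "\<lambda>F. \<forall>s\<in>S. \<not> bad s F"]
      by simp
    have "{F \<in> Pow V. \<forall>s\<in>S. \<not> bad s F}
        = {F \<in> Pow V. True \<and> (\<forall>s\<in>S. \<not> bad s (F - X j))}"
      using avoid by blast
    then have 2: "N S = 2 ^ card (X j) * real c"
      unfolding N_def c_def using card_Pow_split[OF V XV[OF j], of "\<lambda>_. True" "\<lambda>F. \<forall>s\<in>S. \<not> bad s F"]
        finite_subset[OF XV[OF j] V]
      by (simp add: card_Pow flip: Pow_def)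
    show ?thesis unfolding 1 2
      using mult_right_mono[OF p[OF j], of "real c"] by (simp add: mult.assoc)
  qed
  have finV: "finite {F \<in> Pow V. P F}" for P using V by simp
  have diff: "N (S \<union> T) \<ge> N S - (\<Sum>t\<in>T. M t S)" if "finite T" for S T
  proof -
    have "{F \<in> Pow V. \<forall>s\<in>S. \<not> bad s F} \<subseteq> {F \<in> Pow V. \<forall>s\<in>S \<union> T. \<not> bad s F}
            \<union> (\<Union>t\<in>T. {F \<in> Pow V. bad t F \<and> (\<forall>s\<in>S. \<not> bad s F)})"
      by blast
    then have "card {F \<in> Pow V. \<forall>s\<in>S. \<not> bad s F} \<le> card ({F \<in> Pow V. \<forall>s\<in>S \<union> T. \<not> bad s F}
            \<union> (\<Union>t\<in>T. {F \<in> Pow V. bad t F \<and> (\<forall>s\<in>S. \<not> bad s F)}))"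
      by (rule card_mono[rotated]) (use V that in auto)
    also have "\<dots> \<le> card {F \<in> Pow V. \<forall>s\<in>S \<union> T. \<not> bad s F}
          + card (\<Union>t\<in>T. {F \<in> Pow V. bad t F \<and> (\<forall>s\<in>S. \<not> bad s F)})"
      by (rule card_Un_le)
    also have "\<dots> \<le> card {F \<in> Pow V. \<forall>s\<in>S \<union> T. \<not> bad s F}
          + (\<Sum>t\<in>T. card {F \<in> Pow V. bad t F \<and> (\<forall>s\<in>S. \<not> bad s F)})"
      using card_UN_le[OF that] by (rule add_left_mono)
    finally show ?thesis unfolding N_def M_def by (simp flip: of_nat_sum of_nat_add)
  qed
  \<comment> \<open>Conditioned on avoiding \<open>S\<close>, the event \<open>bad j\<close> has
    probability at most \<open>2 * p\<close>. Only the events in \<open>T\<close> depend on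
    \<open>bad j\<close>. Given that \<open>S - T\<close> is avoided, some event of \<open>T\<close>
    occurs with probability at most \<open>d * (2 * p) \<le> 1/2\<close> by induction, so passing
    from \<open>S\<close> to \<open>S - T\<close> costs a factor 2.\<close>
  have key: "M j S \<le> 2 * p * N S" if "j \<in> J" "S \<subseteq> J" for j S
    using that
  proof (induction "card S" arbitrary: j S rule: less_induct)
    case less
    define T where "T = {s \<in> S. X s \<inter> X j \<noteq> {}}"
    have fS: "finite S" using less.prems(2) J finite_subset by blast
    have ST: "S = (S - T) \<union> T" by (auto simp: T_def)
    have *: "M j (S - T) \<le> p * N (S - T)"
      by (rule indep) (use less.prems in \<open>auto simp: T_def\<close>)
    have half: "N (S - T) \<le> 2 * N S"
    proof (cases "T = {}")
      case True
      then show ?thesis using N0[of S] by simp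
    next
      case False
      have "card (S - T) < card S"
        by (rule psubset_card_mono) (use fS False in \<open>auto simp: T_def\<close>)
      then have "M t (S - T) \<le> 2 * p * N (S - T)" if "t \<in> T" for t
        using less.hyps[of "S - T" t] less.prems that by (auto simp: T_def)
      then have "(\<Sum>t\<in>T. M t (S - T)) \<le> real (card T) * (2 * p * N (S - T))"
        using sum_bounded_above[of T "\<lambda>t. M t (S - T)"] by simp
      also have "\<dots> \<le> d * (2 * p * N (S - T))"
      proof (rule mult_right_mono)
        have "card T \<le> card {k \<in> J. X k \<inter> X j \<noteq> {}}"
          by (rule card_mono) (use J less.prems in \<open>auto simp: T_def\<close>)
        then show "real (card T) \<le> d" using d[OF less.prems(1)] by linarith
        show "0 \<le> 2 * p * N (S - T)" using N0 pd by simp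
      qed
      also have "\<dots> = (4 * p * d) * (N (S - T) / 2)" by simp
      also have "\<dots> \<le> 1 * (N (S - T) / 2)"
        by (rule mult_right_mono) (use pd N0 in auto)
      finally have "(\<Sum>t\<in>T. M t (S - T)) \<le> N (S - T) / 2" by simp
      moreover have "N S \<ge> N (S - T) - (\<Sum>t\<in>T. M t (S - T))"
        using diff[of T "S - T"] ST fS finite_subset[of T S] by (auto simp: T_def)
      ultimately show ?thesis by simp
    qed
    have "M j S \<le> M j (S - T)"
      unfolding M_def by (intro of_nat_mono card_mono) (use V in auto)
    also have "\<dots> \<le> p * (2 * N S)" using * half mult_left_mono[OF half pd(1)] by linarith
    finally show ?case by simp
  qed
  have pos: "N S > 0" if "S \<subseteq> J" for S
    using finite_subset[OF that J] that
  proof (induction S rule: finite_induct)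
    case empty
    have "{F \<in> Pow V. \<forall>s\<in>{}. \<not> bad s F} = Pow V" by auto
    then show ?case using V by (simp add: N_def card_Pow)
  next
    case (insert j S)
    have "N (insert j S) \<ge> N S - M j S" using diff[of "{j}" S] by simp
    moreover have "M j S \<le> 2 * p * N S" using key insert by auto
    moreover have "2 * p * N S < 1 * N S"
      using insert pd by (intro mult_strict_right_mono) auto
    ultimately show ?case by linarith
  qed
  have "{F \<in> Pow V. \<forall>s\<in>J. \<not> bad s F} \<noteq> {}"
    using pos[of J] by (auto simp: N_def card_gt_0_iff)
  then show ?thesis using that by auto
qed

section \<open>Chernoff bound for uniform subsets, and balanced splittings\<close>

lemma sum_power_card_Pow:
  fixes z w :: "'b :: comm_semiring_1"
  assumes "finite X"
  shows "(\<Sum>F\<in>Pow X. z ^ card F * w ^ card (X - F)) = (z + w) ^ card X"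
  using prod_add[OF assms, of "\<lambda>_. z" "\<lambda>_. w"] by simp

text \<open>A weak form of \<open>cosh l \<le> exp (l\<^sup>2 / 2)\<close>; losing the factor 1/2
  lets quadratic estimates of \<open>exp\<close> on the unit interval suffice.\<close>

lemma exp_add_exp_minus_le:
  fixes l :: real
  assumes "0 \<le> l" "l \<le> 1"
  shows "exp l + exp (- l) \<le> 2 * exp (l\<^sup>2)"
proof -
  have "exp (- l) \<le> 1 - l + l\<^sup>2"
  proof -
    have "(1 + l) * exp (-l) \<le> exp l * exp (-l)"
      by (intro mult_right_mono exp_ge_add_one_self) simp
    then have "exp (-l) \<le> 1 / (1 + l)" using assms by (simp add: field_simps flip: exp_add)
    also have "1 / (1 + l) \<le> 1 - l + l\<^sup>2"
    proof -
      \<comment> \<open>The right-hand side is \<open>(1 + l) * (1 - l + l\<^sup>2)\<close>.\<close>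
      have "1 \<le> 1 + l * (l * l)" using assms by simp
      then show ?thesis using assms by (simp add: field_simps power2_eq_square)
    qed
    finally show ?thesis .
  qed
  moreover have "exp l \<le> 1 + l + l\<^sup>2" using exp_bound assms by blast
  moreover have "1 + l\<^sup>2 \<le> exp (l\<^sup>2)" by (rule exp_ge_add_one_self)
  ultimately show ?thesis by linarith
qed

text \<open>Markov's inequality for \<open>exp (l * (2 * card F - card X))\<close>, whose sum over
  all \<open>F\<close> is computed by the binomial identity. Only an upper bound \<open>x\<close> on
  the size is assumed, so sets of different sizes share one threshold.\<close>

lemma card_large_subsets_le:
  fixes s x :: real
  assumes X: "finite X" and x: "real (card X) \<le> x" "0 < x" and s: "0 \<le> s" "s \<le> x"
  shows "real (card {F \<in> Pow X. real (card F) > x / 2 + s}) \<le> exp (- s\<^sup>2 / x) * 2 ^ card X"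
proof -
  \<comment> \<open>The minimum of the final exponent \<open>x * l\<^sup>2 - 2 * l * s\<close>;
    \<open>s \<le> x\<close> keeps it in the range of the \<open>cosh\<close> estimate.\<close>
  define l where "l = s / x"
  have l: "0 \<le> l" "l \<le> 1" using assms by (auto simp: l_def)
  let ?L = "{F \<in> Pow X. real (card F) > x / 2 + s}"
  have "real (card ?L) * exp (2 * l * s) \<le> (\<Sum>F\<in>?L. exp l ^ card F * exp (-l) ^ card (X - F))"
  proof -
    have "exp (2 * l * s) \<le> exp l ^ card F * exp (-l) ^ card (X - F)" if F: "F \<in> ?L" for F
    proof -
      have "card (X - F) = card X - card F" "card F \<le> card X"
        using F X by (auto simp: card_Diff_subset finite_subset card_mono)
      then have "exp l ^ card F * exp (-l) ^ card (X - F) = exp (l * (2 * real (card F) - real (card X)))"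
        by (simp add: algebra_simps of_nat_diff flip: exp_of_nat_mult exp_add)
      moreover have "l * (2 * s) \<le> l * (2 * real (card F) - real (card X))"
        using F x l by (intro mult_left_mono) auto
      ultimately show ?thesis by (simp add: algebra_simps)
    qed
    then show ?thesis using sum_bounded_below[of ?L "exp (2 * l * s)"] by simp
  qed
  also have "\<dots> \<le> (\<Sum>F\<in>Pow X. exp l ^ card F * exp (-l) ^ card (X - F))"
    by (rule sum_mono2) (use X in auto)
  also have "\<dots> = (exp l + exp (-l)) ^ card X" by (rule sum_power_card_Pow[OF X])
  also have "\<dots> \<le> (2 * exp (l\<^sup>2)) ^ card X"
    by (intro power_mono exp_add_exp_minus_le l) (simp add: add_nonneg_nonneg)
  also have "\<dots> = 2 ^ card X * exp (real (card X) * l\<^sup>2)"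
    by (simp add: power_mult_distrib exp_of_nat_mult)
  also have "\<dots> \<le> 2 ^ card X * exp (x * l\<^sup>2)"
    using x by (simp add: mult_right_mono)
  finally have "real (card ?L) \<le> 2 ^ card X * exp (x * l\<^sup>2) / exp (2 * l * s)"
    by (simp add: field_simps)
  also have "\<dots> = 2 ^ card X * exp (x * l\<^sup>2 - 2 * l * s)" by (simp add: exp_diff)
  also have "x * l\<^sup>2 - 2 * l * s = - s\<^sup>2 / x"
    using x by (simp add: l_def field_simps power2_eq_square)
  finally show ?thesis by (simp add: mult.commute)
qed

text \<open>The exponent of the error lies below 1, so degrees really halve, and above 1/2, so the
  failure probability decays faster than any power of \<open>x\<close>.\<close>

definition halving_bound :: "real \<Rightarrow> real" where
  "halving_bound x = x / 2 + x powr (2/3)"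

text \<open>The second condition on \<open>x\<close> is \<open>4 * p * d \<le> 1\<close> of the
  local lemma, with \<open>p = 2 * exp (- (x powr (1/3)))\<close> (one tail per half) and
  \<open>d = 2 * x\<^sup>2\<close> (at most \<open>x\<close> elements, each in at most
  \<open>2 * x\<close> sets).\<close>

lemma balanced_splitting:
  fixes x :: real
  assumes V: "finite V" and J: "\<And>X. X \<in> J \<Longrightarrow> X \<subseteq> V \<and> real (card X) \<le> x"
    and deg: "\<And>u. u \<in> V \<Longrightarrow> real (card {X \<in> J. u \<in> X}) \<le> 2 * x"
    and x: "1 \<le> x" "16 * x\<^sup>2 * exp (- (x powr (1/3))) \<le> 1"
  obtains F where "\<And>X. X \<in> J \<Longrightarrow> real (card (X \<inter> F)) \<le> halving_bound x \<and> real (card (X - F)) \<le> halving_bound x"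
proof -
  define bad where "bad X F \<longleftrightarrow> real (card (X \<inter> F)) > halving_bound x \<or> real (card (X - F)) > halving_bound x" for X F :: "'a set"
  define p where "p = 2 * exp (- (x powr (1/3)))"
  define s where "s = x powr (2/3)"
  have fJ: "finite J" using J V by (intro finite_subset[of J "Pow V"]) auto
  have s: "0 \<le> s" "s \<le> x" using x powr_mono[of "2/3" 1 x] by (auto simp: s_def)
  have sx: "s\<^sup>2 / x = x powr (1/3)"
  proof -
    have "s\<^sup>2 = x powr (4/3)" using x by (simp add: s_def powr_powr flip: powr_numeral)
    also have "\<dots> / x = x powr (1/3)" using x powr_diff[of x "4/3" 1] by simp
    finally show ?thesis .
  qed
  have "16 * 1 * exp (- (x powr (1/3))) \<le> 16 * x\<^sup>2 * exp (- (x powr (1/3)))"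
    using x by (intro mult_right_mono mult_left_mono) (auto simp: one_le_power)
  then have "16 * exp (- (x powr (1/3))) \<le> 1" using x by linarith
  then have p1: "2 * p < 1" unfolding p_def by simp
  obtain F where "\<And>X. X \<in> J \<Longrightarrow> \<not> bad X F"
  proof (rule lovasz_local_lemma[of V J "\<lambda>X. X" bad p "2 * x\<^sup>2"])
    fix X F assume "X \<in> J"
    have "X \<inter> F = X \<inter> (F \<inter> X)" "X - F = X - (F \<inter> X)" by auto
    then show "bad X F \<longleftrightarrow> bad X (F \<inter> X)" unfolding bad_def by metis
  next
    fix X assume X: "X \<in> J"
    have fX: "finite X" using J[OF X] V finite_subset by auto
    have cX: "real (card X) \<le> x" using J[OF X] by simp
    let ?L = "{F \<in> Pow X. real (card F) > x / 2 + s}"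
    have L: "real (card ?L) \<le> exp (- (x powr (1/3))) * 2 ^ card X"
      using card_large_subsets_le[OF fX cX _ s] x sx by simp
    \<comment> \<open>Complementation in \<open>X\<close> turns an excess outside \<open>F\<close>
      into an excess inside, so both failures have the same bound.\<close>
    have "{F \<in> Pow X. bad X F} \<subseteq> ?L \<union> (\<lambda>F. X - F) ` ?L"
    proof
      fix F assume F: "F \<in> {F \<in> Pow X. bad X F}"
      then have "X \<inter> F = F" "X - (X - F) = F" by auto
      with F show "F \<in> ?L \<union> (\<lambda>F. X - F) ` ?L"
        by (auto simp: bad_def halving_bound_def s_def intro!: image_eqI[of F "\<lambda>F. X - F" "X - F"])
    qed
    then have "card {F \<in> Pow X. bad X F} \<le> card (?L \<union> (\<lambda>F. X - F) ` ?L)"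
      by (intro card_mono) (use fX in auto)
    also have "\<dots> \<le> card ?L + card ((\<lambda>F. X - F) ` ?L)" by (rule card_Un_le)
    also have "\<dots> \<le> card ?L + card ?L" using fX by (intro add_left_mono card_image_le) simp
    finally show "real (card {F \<in> Pow X. bad X F}) \<le> p * 2 ^ card X"
      using L by (simp add: p_def)
    have "{Y \<in> J. Y \<inter> X \<noteq> {}} = (\<Union>u\<in>X. {Y \<in> J. u \<in> Y})" by auto
    then have "card {Y \<in> J. Y \<inter> X \<noteq> {}} \<le> (\<Sum>u\<in>X. card {Y \<in> J. u \<in> Y})"
      using card_UN_le[OF fX] by simp
    then have "real (card {Y \<in> J. Y \<inter> X \<noteq> {}}) \<le> (\<Sum>u\<in>X. real (card {Y \<in> J. u \<in> Y}))"
      by (simp flip: of_nat_sum)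
    also have "\<dots> \<le> real (card X) * (2 * x)"
      by (rule sum_bounded_above) (use J X deg in auto)
    also have "\<dots> \<le> x * (2 * x)" using cX x by (intro mult_right_mono) auto
    finally show "real (card {Y \<in> J. Y \<inter> X \<noteq> {}}) \<le> 2 * x\<^sup>2"
      by (simp add: power2_eq_square)
  qed (use V fJ J p1 x in \<open>auto simp: p_def algebra_simps\<close>)
  then show ?thesis using that[of F] unfolding bad_def by (meson not_le_imp_less)
qed

section \<open>Separating the non-edges\<close>

text \<open>Both quantifiers range over the whole type, so no vertex set has to be carried along:
  vertices outside the current pair receive \<open>UNIV\<close>.\<close>

definition interval_supergraph :: "'a set set \<Rightarrow> ('a \<Rightarrow> real set) \<Rightarrow> bool" where
  "interval_supergraph E I \<longleftrightarrow>
     (\<forall>v. real_interval (I v)) \<and> (\<forall>u v. u \<noteq> v \<longrightarrow> {u, v} \<in> E \<longrightarrow> I u \<inter> I v \<noteq> {})"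

text \<open>A local box representation is a list of interval supergraphs that separates all non-edges.
  The number of bounded intervals at \<open>v\<close>, limited by \<open>c v\<close>, is additive under concatenation.\<close>

definition separable :: "'a set set \<Rightarrow> ('a \<times> 'a) set \<Rightarrow> ('a \<Rightarrow> real) \<Rightarrow> bool" where
  "separable E R c \<longleftrightarrow> (\<exists>Is. (\<forall>I\<in>set Is. interval_supergraph E I) \<and>
     (\<forall>(u, v)\<in>R. u \<noteq> v \<longrightarrow> {u, v} \<notin> E \<longrightarrow> (\<exists>I\<in>set Is. I u \<inter> I v = {})) \<and>
     (\<forall>v. real (length (filter (\<lambda>I. bounded (I v)) Is)) \<le> c v))"

lemma separable_mono:
  assumes "separable E R c" "R' \<subseteq> R" "\<And>v. c v \<le> c' v"
  shows "separable E R' c'"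
proof -
  obtain Is where Is: "\<forall>I\<in>set Is. interval_supergraph E I"
    "\<forall>(u, v)\<in>R. u \<noteq> v \<longrightarrow> {u, v} \<notin> E \<longrightarrow> (\<exists>I\<in>set Is. I u \<inter> I v = {})"
    "\<forall>v. real (length (filter (\<lambda>I. bounded (I v)) Is)) \<le> c v"
    using assms(1) unfolding separable_def by (elim exE conjE)
  show ?thesis unfolding separable_def
  proof (intro exI[of _ Is] conjI allI)
    show "real (length (filter (\<lambda>I. bounded (I v)) Is)) \<le> c' v" for v
      using Is(3) assms(3)[of v] order_trans by blast
  qed (use Is assms(2) in auto)
qed

lemma separable_empty: "separable E {} (\<lambda>_. 0)"
  unfolding separable_def by (rule exI[of _ "[]"]) simp

lemma separable_Un:
  assumes "separable E R c" "separable E R' c'"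
  shows "separable E (R \<union> R') (\<lambda>v. c v + c' v)"
proof -
  obtain Is where Is: "\<forall>I\<in>set Is. interval_supergraph E I"
    "\<forall>(u, v)\<in>R. u \<noteq> v \<longrightarrow> {u, v} \<notin> E \<longrightarrow> (\<exists>I\<in>set Is. I u \<inter> I v = {})"
    "\<forall>v. real (length (filter (\<lambda>I. bounded (I v)) Is)) \<le> c v"
    using assms(1) unfolding separable_def by (elim exE conjE)
  obtain Js where Js: "\<forall>I\<in>set Js. interval_supergraph E I"
    "\<forall>(u, v)\<in>R'. u \<noteq> v \<longrightarrow> {u, v} \<notin> E \<longrightarrow> (\<exists>I\<in>set Js. I u \<inter> I v = {})"
    "\<forall>v. real (length (filter (\<lambda>I. bounded (I v)) Js)) \<le> c' v"
    using assms(2) unfolding separable_def by (elim exE conjE)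
  show ?thesis unfolding separable_def
  proof (intro exI[of _ "Is @ Js"] conjI)
    show "\<forall>I\<in>set (Is @ Js). interval_supergraph E I" using Is(1) Js(1) by auto
    show "\<forall>(u, v)\<in>R \<union> R'. u \<noteq> v \<longrightarrow> {u, v} \<notin> E \<longrightarrow> (\<exists>I\<in>set (Is @ Js). I u \<inter> I v = {})"
    proof (intro ballI, clarify)
      fix u v assume "(u, v) \<in> R \<union> R'" "u \<noteq> v" "{u, v} \<notin> E"
      then show "\<exists>I\<in>set (Is @ Js). I u \<inter> I v = {}"
        using bspec[OF Is(2), of "(u, v)"] bspec[OF Js(2), of "(u, v)"] by auto
    qed
    show "\<forall>v. real (length (filter (\<lambda>I. bounded (I v)) (Is @ Js))) \<le> c v + c' v"
      using Is(3) Js(3) by (simp add: add_mono)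
  qed
qed

lemma separable_UN:
  assumes "finite K" "\<And>k. k \<in> K \<Longrightarrow> separable E (R k) (c k)"
  shows "separable E (\<Union>k\<in>K. R k) (\<lambda>v. \<Sum>k\<in>K. c k v)"
  using assms
proof (induction K rule: finite_induct)
  case empty
  then show ?case by (simp add: separable_empty)
next
  case (insert k K)
  then show ?case using separable_Un[of E "R k" "c k" "\<Union>k\<in>K. R k"] by simp
qed

section \<open>Separators using at most two intervals per vertex\<close>

lemma real_interval_simps [simp]:
  "real_interval UNIV" "real_interval {a}" "real_interval {a..b} \<longleftrightarrow> a \<le> b"
  using is_interval_cc[of a a] by (auto simp: real_interval_def)

text \<open>Distinct points on \<open>W\<close> and \<open>UNIV\<close> elsewhere: every edge has an
  endpoint outside \<open>W\<close> and so keeps meeting intervals.\<close>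

lemma separable_independent:
  assumes "finite W" "\<And>u v. u \<in> W \<Longrightarrow> v \<in> W \<Longrightarrow> u \<noteq> v \<Longrightarrow> {u, v} \<notin> E"
  shows "separable E (W \<times> W) (\<lambda>v. of_bool (v \<in> W))"
proof -
  obtain g :: "'a \<Rightarrow> nat" where g: "inj_on g W"
    using finite_imp_inj_to_nat_seg[OF assms(1)] by blast
  define I where "I v = (if v \<in> W then {real (g v)..real (g v)} else UNIV)" for v
  show ?thesis unfolding separable_def
  proof (intro exI[of _ "[I]"] conjI)
    show "\<forall>I\<in>set [I]. interval_supergraph E I"
      using assms(2) by (auto simp: interval_supergraph_def I_def)
    show "\<forall>(u, v)\<in>W \<times> W. u \<noteq> v \<longrightarrow> {u, v} \<notin> E \<longrightarrow> (\<exists>I\<in>set [I]. I u \<inter> I v = {})"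
      using g by (auto simp: I_def inj_on_def)
    show "\<forall>v. real (length (filter (\<lambda>I. bounded (I v)) [I])) \<le> of_bool (v \<in> W)"
      using not_bounded_UNIV[where ?'a = real] by (auto simp: I_def)
  qed
qed

text \<open>Uniqueness allows each \<open>b\<close> to sit at the position of its only neighbour in
  \<open>W\<close>, so adjacency becomes equality of positions. Two intervals per vertex test this
  equality as two inequalities, whatever the size of \<open>W\<close>.\<close>

lemma separable_unique_neighbour:
  assumes "finite W" "W \<inter> B = {}"
    and uniq: "\<And>w w' b. w \<in> W \<Longrightarrow> w' \<in> W \<Longrightarrow> b \<in> B \<Longrightarrow> {w, b} \<in> E \<Longrightarrow> {w', b} \<in> E \<Longrightarrow> w = w'"
  shows "separable E (W \<times> B) (\<lambda>v. 2 * of_bool (v \<in> W \<union> B))"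
proof -
  obtain g :: "'a \<Rightarrow> nat" and n where g: "inj_on g W" "g ` W = {i. i < n}"
    using finite_imp_inj_to_nat_seg[OF assms(1)] by metis
  have gn: "g w < n" if "w \<in> W" for w using g(2) that by auto
  define h where "h b = (if \<exists>w\<in>W. {w, b} \<in> E then g (SOME w. w \<in> W \<and> {w, b} \<in> E) else n)" for b
  have h_edge: "h b = g w" if "w \<in> W" "b \<in> B" "{w, b} \<in> E" for w b
  proof -
    have "(SOME w. w \<in> W \<and> {w, b} \<in> E) = w"
      by (rule some_equality) (use uniq that in auto)
    then show ?thesis using that by (auto simp: h_def)
  qed
  have h_edge': "h b = g w" if "w \<in> W" "b \<in> B" "{b, w} \<in> E" for w b
    using h_edge[of w b] that by (simp add: insert_commute)
  have h_nonedge: "h b \<noteq> g w" if "w \<in> W" "b \<in> B" "{w, b} \<notin> E" for w b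
  proof (cases "\<exists>w\<in>W. {w, b} \<in> E")
    case True
    then obtain w' where "w' \<in> W" "{w', b} \<in> E" by blast
    then show ?thesis using h_edge[of w' b] that g(1) by (auto simp: inj_on_def)
  next
    case False
    then show ?thesis using gn that by (auto simp: h_def)
  qed
  have hn: "h b \<le> n" if "b \<in> B" for b
  proof (cases "\<exists>w\<in>W. {w, b} \<in> E")
    case True
    then show ?thesis using h_edge gn that by (metis less_imp_le)
  qed (simp add: h_def)
  \<comment> \<open>In \<open>I\<close> the set \<open>W\<close> extends to the left and \<open>B\<close> to the right, in \<open>J\<close> the other way round. So each of
    them is a clique whatever its own edges are, and \<open>w\<close>, \<open>b\<close> meet in both iff \<open>g w = h b\<close>.\<close>
  define I where "I v = (if v \<in> W then {-1..real (g v)} else if v \<in> B then {real (h v)..real n} else UNIV)" for v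
  define J where "J v = (if v \<in> W then {real (g v)..real n} else if v \<in> B then {-1..real (h v)} else UNIV)" for v
  show ?thesis unfolding separable_def
  proof (intro exI[of _ "[I, J]"] conjI)
    have "interval_supergraph E I"
      unfolding interval_supergraph_def
      using h_edge h_edge' gn hn by (auto simp: I_def less_imp_le)
    moreover have "interval_supergraph E J"
      unfolding interval_supergraph_def
      using h_edge h_edge' gn hn by (auto simp: J_def less_imp_le)
    ultimately show "\<forall>I\<in>set [I, J]. interval_supergraph E I" by simp
    have "I u \<inter> I v = {} \<or> J u \<inter> J v = {}" if "u \<in> W" "v \<in> B" "{u, v} \<notin> E" for u v
    proof -
      have "v \<notin> W" using that assms(2) by auto
      then show ?thesis using h_nonedge[OF that] that by (auto simp: I_def J_def)
    qed
    then show "\<forall>(u, v)\<in>W \<times> B. u \<noteq> v \<longrightarrow> {u, v} \<notin> E \<longrightarrow> (\<exists>I\<in>set [I, J]. I u \<inter> I v = {})"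
      by auto
    show "\<forall>v. real (length (filter (\<lambda>I. bounded (I v)) [I, J])) \<le> 2 * of_bool (v \<in> W \<union> B)"
      using not_bounded_UNIV[where ?'a = real] by (auto simp: I_def J_def)
  qed
qed

text \<open>\<open>R\<close> need not be symmetric, so conflicts in both directions count. The
  \<open>k + 1\<close> colours \<open>0..k\<close> always leave one free for the new vertex.\<close>

lemma greedy_colouring:
  assumes "finite A" "\<And>a. a \<in> A \<Longrightarrow> card {a' \<in> A. R a a' \<or> R a' a} \<le> k"
  shows "\<exists>c :: 'a \<Rightarrow> nat. (\<forall>a\<in>A. c a \<le> k) \<and> (\<forall>a\<in>A. \<forall>a'\<in>A. a \<noteq> a' \<longrightarrow> R a a' \<longrightarrow> c a \<noteq> c a')"
  using assms
proof (induction A rule: finite_induct)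
  case empty
  then show ?case by auto
next
  case (insert x A)
  have "card {a' \<in> A. R a a' \<or> R a' a} \<le> k" if "a \<in> A" for a
  proof -
    have "card {a' \<in> A. R a a' \<or> R a' a} \<le> card {a' \<in> insert x A. R a a' \<or> R a' a}"
      by (rule card_mono) (use insert.hyps in auto)
    then show ?thesis using insert.prems[of a] that by simp
  qed
  with insert.IH have "\<exists>c :: 'a \<Rightarrow> nat. (\<forall>a\<in>A. c a \<le> k) \<and> (\<forall>a\<in>A. \<forall>a'\<in>A. a \<noteq> a' \<longrightarrow> R a a' \<longrightarrow> c a \<noteq> c a')"
    by simp
  then obtain c :: "'a \<Rightarrow> nat" where c: "\<forall>a\<in>A. c a \<le> k"
    "\<forall>a\<in>A. \<forall>a'\<in>A. a \<noteq> a' \<longrightarrow> R a a' \<longrightarrow> c a \<noteq> c a'"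
    by (elim exE conjE)
  define T where "T = {a' \<in> A. R x a' \<or> R a' x}"
  have "card (c ` T) \<le> card T" by (rule card_image_le) (use insert.hyps in \<open>auto simp: T_def\<close>)
  also have "\<dots> \<le> card {a' \<in> insert x A. R x a' \<or> R a' x}"
    by (rule card_mono) (use insert.hyps in \<open>auto simp: T_def\<close>)
  also have "\<dots> \<le> k" by (rule insert.prems) simp
  finally have "card (c ` T) < card {..k}" by simp
  then have "\<not> {..k} \<subseteq> c ` T"
    using card_mono[of "c ` T" "{..k}"] insert.hyps by (auto simp: T_def)
  then obtain i where i: "i \<le> k" "i \<notin> c ` T" by auto
  show ?case
  proof (intro exI[of _ "c(x := i)"] conjI ballI impI)
    fix a a' assume "a \<in> insert x A" "a' \<in> insert x A" "a \<noteq> a'" "R a a'"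
    then show "(c(x := i)) a \<noteq> (c(x := i)) a'"
      using c(2) i(2) insert.hyps by (auto simp: T_def)
  qed (use c i in auto)
qed

section \<open>Pairs of bounded degree: quadratic bound and halving\<close>

definition nbrs :: "'a set set \<Rightarrow> 'a set \<Rightarrow> 'a \<Rightarrow> 'a set" where
  "nbrs E S v = {u \<in> S. {u, v} \<in> E}"

text \<open>The sides may overlap or coincide. The bound is real because it is fed with iterates of
  \<open>halving_bound\<close>.\<close>

definition bidegree_le :: "'a set set \<Rightarrow> 'a set \<Rightarrow> 'a set \<Rightarrow> real \<Rightarrow> bool" where
  "bidegree_le E A B x \<longleftrightarrow>
     (\<forall>a\<in>A. real (card (nbrs E B a)) \<le> x) \<and> (\<forall>b\<in>B. real (card (nbrs E A b)) \<le> x)"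

text \<open>Each colour class of \<open>A\<close> has unique neighbours towards \<open>B\<close> and
  costs at most 5 per membership; \<open>x\<^sup>2 + x + 1\<close> bounds the number of colours,
  with at most \<open>D\<^sup>2\<close> conflicts at distance two and \<open>D\<close> along
  edges.\<close>

lemma separable_bounded_degree:
  assumes fin: "finite A" "finite B" and deg: "bidegree_le E A B x"
  shows "separable E (A \<times> B) (\<lambda>v. 5 * (x\<^sup>2 + x + 1) * (of_bool (v \<in> A) + of_bool (v \<in> B)))"
proof (cases "A = {} \<or> B = {}")
  case True
  \<comment> \<open>With both sides empty \<open>bidegree_le\<close> does not constrain
    \<open>x\<close>, which may be negative.\<close>
  have "0 \<le> x\<^sup>2 + x + 1"
  proof -
    have "0 \<le> (x + 1/2)\<^sup>2 + 3/4" by simp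
    also have "\<dots> = x\<^sup>2 + x + 1" by (simp add: power2_eq_square algebra_simps)
    finally show ?thesis .
  qed
  then show ?thesis
    by (intro separable_mono[OF separable_empty]) (use True in auto)
next
  case False
  then obtain a0 b0 where ab: "a0 \<in> A" "b0 \<in> B" by auto
  then have "real (card (nbrs E B a0)) \<le> x" using deg by (auto simp: bidegree_le_def)
  then have x0: "0 \<le> x" using of_nat_0_le_iff order_trans by blast
  define D where "D = nat \<lfloor>x\<rfloor>"
  have Dx: "real D \<le> x" using x0 by (simp add: D_def)
  have degD: "card (nbrs E B a) \<le> D" "card (nbrs E A b) \<le> D" if "a \<in> A" "b \<in> B" for a b
    using deg that by (auto simp: bidegree_le_def D_def le_nat_floor)
  note degA = degD(1)[OF _ ab(2)] and degB = degD(2)[OF ab(1)]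
  define k where "k = D\<^sup>2 + D"
  \<comment> \<open>Colour classes of \<open>R\<close> have at most one neighbour of each \<open>b\<close>, and no edges within \<open>B\<close>.\<close>
  define R where "R a a' \<longleftrightarrow> (\<exists>b\<in>B. {a, b} \<in> E \<and> {a', b} \<in> E) \<or> ({a, a'} \<in> E \<and> (a \<in> B \<or> a' \<in> B))" for a a'
  have fn: "finite (nbrs E A v)" "finite (nbrs E B v)" for v using fin by (auto simp: nbrs_def)
  have "card {a' \<in> A. R a a' \<or> R a' a} \<le> k" if a: "a \<in> A" for a
  proof -
    \<comment> \<open>Conflicts along edges. For \<open>a\<close> in \<open>B\<close> the degree of
      \<open>a\<close> into \<open>A\<close> is bounded; otherwise the other endpoint must lie in
      \<open>B\<close>.\<close>
    define S where "S = (if a \<in> B then nbrs E A a else nbrs E B a)"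
    have S: "finite S" "card S \<le> D" using fn degA degB a by (auto simp: S_def)
    have "{a' \<in> A. R a a' \<or> R a' a} \<subseteq> (\<Union>b\<in>nbrs E B a. nbrs E A b) \<union> S"
      by (auto simp: R_def S_def nbrs_def insert_commute)
    then have "card {a' \<in> A. R a a' \<or> R a' a} \<le> card ((\<Union>b\<in>nbrs E B a. nbrs E A b) \<union> S)"
      by (rule card_mono[rotated]) (use fn S in auto)
    also have "\<dots> \<le> card (\<Union>b\<in>nbrs E B a. nbrs E A b) + card S" by (rule card_Un_le)
    also have "card (\<Union>b\<in>nbrs E B a. nbrs E A b) \<le> (\<Sum>b\<in>nbrs E B a. card (nbrs E A b))"
      by (rule card_UN_le) (rule fn)
    also have "\<dots> \<le> of_nat (card (nbrs E B a)) * D"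
      by (rule sum_bounded_above) (use degB in \<open>auto simp: nbrs_def\<close>)
    also have "\<dots> \<le> D * D" using degA[OF a] by simp
    finally show ?thesis using S by (simp add: k_def power2_eq_square)
  qed
  from greedy_colouring[of A R k] fin(1) this
  have "\<exists>c :: 'a \<Rightarrow> nat. (\<forall>a\<in>A. c a \<le> k) \<and> (\<forall>a\<in>A. \<forall>a'\<in>A. a \<noteq> a' \<longrightarrow> R a a' \<longrightarrow> c a \<noteq> c a')"
    by simp
  then
  obtain c :: "'a \<Rightarrow> nat" where "\<forall>a\<in>A. c a \<le> k"
    "\<forall>a\<in>A. \<forall>a'\<in>A. a \<noteq> a' \<longrightarrow> R a a' \<longrightarrow> c a \<noteq> c a'" by (elim exE conjE)
  then have c: "\<And>a. a \<in> A \<Longrightarrow> c a \<le> k"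
    "\<And>a a'. a \<in> A \<Longrightarrow> a' \<in> A \<Longrightarrow> a \<noteq> a' \<Longrightarrow> R a a' \<Longrightarrow> c a \<noteq> c a'" by auto
  define W where "W i = {a \<in> A. c a = i}" for i
  have uniq: "w = w'" if "w \<in> W i" "w' \<in> W i" "b \<in> B" "{w, b} \<in> E" "{w', b} \<in> E" for w w' b i
    using c(2)[of w w'] that by (auto simp: W_def R_def)
  \<comment> \<open>The unique-neighbour separator needs disjoint sides, but a class may meet
    \<open>B\<close>. It is cut accordingly, and its part inside \<open>B\<close>, which is
    independent, is handled separately; the costs are 2, 2 and 1.\<close>
  have sep: "separable E ((W i - B) \<times> B \<union> (W i \<inter> B) \<times> (B - W i) \<union> (W i \<inter> B) \<times> (W i \<inter> B))
     (\<lambda>v. 5 * (of_bool (v \<in> A) + of_bool (v \<in> B)))" for i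
  proof (rule separable_mono)
    show "separable E ((W i - B) \<times> B \<union> (W i \<inter> B) \<times> (B - W i) \<union> (W i \<inter> B) \<times> (W i \<inter> B))
      (\<lambda>v. 2 * of_bool (v \<in> (W i - B) \<union> B) + 2 * of_bool (v \<in> (W i \<inter> B) \<union> (B - W i))
             + of_bool (v \<in> W i \<inter> B))"
    proof (intro separable_Un separable_unique_neighbour separable_independent)
      show "{u, v} \<notin> E" if "u \<in> W i \<inter> B" "v \<in> W i \<inter> B" "u \<noteq> v" for u v
        using c(2)[of u v] that by (auto simp: W_def R_def)
    qed (use uniq fin in \<open>auto simp: W_def\<close>)
    show "2 * of_bool (v \<in> (W i - B) \<union> B) + 2 * of_bool (v \<in> (W i \<inter> B) \<union> (B - W i))
             + of_bool (v \<in> W i \<inter> B) \<le> (5 * (of_bool (v \<in> A) + of_bool (v \<in> B)) :: real)" for v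
      by (auto simp: W_def)
  qed auto
  show ?thesis
  proof (rule separable_mono[OF separable_UN[OF _ sep]])
    show "A \<times> B \<subseteq> (\<Union>i\<in>{..k}. (W i - B) \<times> B \<union> (W i \<inter> B) \<times> (B - W i) \<union> (W i \<inter> B) \<times> (W i \<inter> B))"
      using c(1) by (auto simp: W_def)
    have "(real D)\<^sup>2 \<le> x\<^sup>2" using Dx by (intro power_mono) auto
    moreover have "real k = (real D)\<^sup>2 + real D" by (simp add: k_def)
    ultimately have "real k + 1 \<le> x\<^sup>2 + x + 1" using Dx by linarith
    then show "(\<Sum>i\<le>k. 5 * (of_bool (v \<in> A) + of_bool (v \<in> B)))
        \<le> 5 * (x\<^sup>2 + x + 1) * (of_bool (v \<in> A) + of_bool (v \<in> B))" for v
      by (simp add: algebra_simps)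
  qed simp
qed

text \<open>A single \<open>F\<close> splits both sides, so it must balance the neighbourhoods of
  both kinds at once. Restricting a neighbourhood to a half is intersecting it with \<open>F\<close>
  or its complement, which is exactly what the splitting controls.\<close>

lemma separable_halving:
  fixes t x :: real
  assumes fin: "finite A" "finite B" and deg: "bidegree_le E A B x"
    and x: "1 \<le> x" "16 * x\<^sup>2 * exp (- (x powr (1/3))) \<le> 1"
    and IH: "\<And>A B. finite A \<Longrightarrow> finite B \<Longrightarrow> bidegree_le E A B (halving_bound x) \<Longrightarrow>
      separable E (A \<times> B) (\<lambda>v. t * (of_bool (v \<in> A) + of_bool (v \<in> B)))"
  shows "separable E (A \<times> B) (\<lambda>v. 2 * t * (of_bool (v \<in> A) + of_bool (v \<in> B)))"
proof -
  have fn: "finite (nbrs E A v)" "finite (nbrs E B v)" for v using fin by (auto simp: nbrs_def)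
  define J where "J = nbrs E B ` A \<union> nbrs E A ` B"
  obtain F where F: "\<And>X. X \<in> J \<Longrightarrow> real (card (X \<inter> F)) \<le> halving_bound x \<and> real (card (X - F)) \<le> halving_bound x"
  proof (rule balanced_splitting[of "A \<union> B" J x])
    show "X \<subseteq> A \<union> B \<and> real (card X) \<le> x" if "X \<in> J" for X
      using that deg by (auto simp: J_def bidegree_le_def nbrs_def)
    show "real (card {X \<in> J. u \<in> X}) \<le> 2 * x" if "u \<in> A \<union> B" for u
    proof -
      \<comment> \<open>\<open>nbrs E B a\<close> contains \<open>u\<close> only if \<open>u\<close>
        is in \<open>B\<close> and \<open>a\<close> is one of the at most \<open>x\<close>
        neighbours of \<open>u\<close> in \<open>A\<close>; symmetrically for the other kind. This
        gives \<open>2 * x\<close> in total.\<close>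
      define SB where "SB = (if u \<in> A then nbrs E B u else {})"
      define SA where "SA = (if u \<in> B then nbrs E A u else {})"
      have S: "finite SA" "finite SB" "real (card SA) \<le> x" "real (card SB) \<le> x"
        using fn deg x by (auto simp: SA_def SB_def bidegree_le_def)
      have "{X \<in> J. u \<in> X} \<subseteq> nbrs E B ` SA \<union> nbrs E A ` SB"
      proof
        fix X assume X: "X \<in> {X \<in> J. u \<in> X}"
        then consider a where "a \<in> A" "X = nbrs E B a" | b where "b \<in> B" "X = nbrs E A b"
          by (auto simp: J_def)
        then show "X \<in> nbrs E B ` SA \<union> nbrs E A ` SB"
        proof cases
          case (1 a)
          then have "a \<in> SA" using X by (auto simp: SA_def nbrs_def insert_commute)
          then show ?thesis using 1 by blast
        next
          case (2 b)
          then have "b \<in> SB" using X by (auto simp: SB_def nbrs_def insert_commute)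
          then show ?thesis using 2 by blast
        qed
      qed
      then have "card {X \<in> J. u \<in> X} \<le> card (nbrs E B ` SA \<union> nbrs E A ` SB)"
        by (rule card_mono[rotated]) (use S in auto)
      also have "\<dots> \<le> card (nbrs E B ` SA) + card (nbrs E A ` SB)" by (rule card_Un_le)
      also have "\<dots> \<le> card SA + card SB" using S by (intro add_mono card_image_le)
      finally show ?thesis using S by simp
    qed
  qed (use fin x in auto)
  define P where "P S i = (if i then S \<inter> F else S - F)" for S and i :: bool
  have nP: "nbrs E (P S i) v = P (nbrs E S v) i" for S i v by (auto simp: P_def nbrs_def)
  have "separable E (P A i \<times> P B j) (\<lambda>v. t * (of_bool (v \<in> P A i) + of_bool (v \<in> P B j)))" for i j
  proof (rule IH)
    show "finite (P A i)" "finite (P B j)" using fin by (auto simp: P_def)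
    have "real (card (nbrs E (P B j) a)) \<le> halving_bound x" if "a \<in> A" for a
      using F[of "nbrs E B a"] that unfolding nP by (auto simp: J_def P_def)
    moreover have "real (card (nbrs E (P A i) b)) \<le> halving_bound x" if "b \<in> B" for b
      using F[of "nbrs E A b"] that unfolding nP by (auto simp: J_def P_def)
    ultimately show "bidegree_le E (P A i) (P B j) (halving_bound x)"
      by (auto simp: bidegree_le_def P_def split: if_splits)
  qed
  then have *: "separable E (\<Union>(i, j)\<in>UNIV. P A i \<times> P B j)
     (\<lambda>v. \<Sum>(i, j)\<in>UNIV. t * (of_bool (v \<in> P A i) + of_bool (v \<in> P B j)))"
    using separable_UN[of UNIV E "\<lambda>(i, j). P A i \<times> P B j"
        "\<lambda>(i, j) v. t * (of_bool (v \<in> P A i) + of_bool (v \<in> P B j))"]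
    by (simp add: case_prod_unfold)
  show ?thesis
  proof (rule separable_mono[OF *])
    show "A \<times> B \<subseteq> (\<Union>(i, j)\<in>UNIV. P A i \<times> P B j)" by (auto simp: P_def)
    show "(\<Sum>(i, j)\<in>UNIV. t * (of_bool (v \<in> P A i) + of_bool (v \<in> P B j)))
      \<le> 2 * t * (of_bool (v \<in> A) + of_bool (v \<in> B))" for v
      by (auto simp: P_def UNIV_bool simp flip: UNIV_Times_UNIV sum.cartesian_product)
  qed
qed

text \<open>The correction term absorbs the error \<open>x powr (2/3)\<close> of all the halvings, as
  \<open>2 powr (1/4) > 1\<close> and \<open>3/4 > 2/3\<close>.\<close>

definition potential :: "real \<Rightarrow> real" where
  "potential x = x - x powr (3/4)"

lemma eventually_halving_conditions:
  "eventually (\<lambda>x. 1 \<le> x \<and> 16 * x\<^sup>2 * exp (- (x powr (1/3))) \<le> 1 \<and> halving_bound x \<le> 2 / 3 * x \<and>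
     1 \<le> potential x \<and> 2 * potential (halving_bound x) \<le> potential x) at_top"
proof (intro eventually_conj)
  show "eventually (\<lambda>x::real. 16 * x\<^sup>2 * exp (- (x powr (1/3))) \<le> 1) at_top" by real_asymp
  show "eventually (\<lambda>x. halving_bound x \<le> 2 / 3 * x) at_top" unfolding halving_bound_def by real_asymp
  show "eventually (\<lambda>x. 1 \<le> potential x) at_top" unfolding potential_def by real_asymp
  have c: "2 * (1/2::real) powr (3/4) > 1"
  proof -
    have "(1/2::real) powr 1 < (1/2) powr (3/4)" by (rule powr_less_mono') auto
    then show ?thesis by simp
  qed
  \<comment> \<open>After cancelling \<open>x\<close>, this implies the last condition, as
    \<open>halving_bound x \<ge> x / 2\<close>.\<close>
  have "eventually (\<lambda>x::real. 2 * x powr (2/3) + x powr (3/4) \<le> (2 * (1/2) powr (3/4)) * x powr (3/4)) at_top"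
    using c by real_asymp
  moreover have "eventually (\<lambda>x::real. x > 0) at_top" by (rule eventually_gt_at_top)
  ultimately show "eventually (\<lambda>x. 2 * potential (halving_bound x) \<le> potential x) at_top"
  proof eventually_elim
    case (elim x)
    have "(x / 2) powr (3/4) \<le> halving_bound x powr (3/4)"
      using elim by (intro powr_mono2) (auto simp: halving_bound_def)
    then have "(1/2) powr (3/4) * x powr (3/4) \<le> halving_bound x powr (3/4)"
      using elim powr_mult[of "1/2" x "3/4"] by simp
    then show ?case using elim unfolding potential_def by (simp add: halving_bound_def)
  qed
qed (rule eventually_ge_at_top)

text \<open>\<open>potential\<close> solves the recursion as an inequality, so no errors accumulate.
  Halving stops at or below \<open>2 * x1\<close>, where the quadratic bound is at most a
  constant.\<close>

lemma separable_linear: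
  obtains K x1 :: real where "K > 0" "x1 \<ge> 1"
    "\<And>E (A :: 'a set) B x. finite A \<Longrightarrow> finite B \<Longrightarrow> x1 \<le> x \<Longrightarrow> bidegree_le E A B x \<Longrightarrow>
        separable E (A \<times> B) (\<lambda>v. K * x * (of_bool (v \<in> A) + of_bool (v \<in> B)))"
proof -
  obtain x1 where x1: "\<And>x. x \<ge> x1 \<Longrightarrow> 1 \<le> x \<and> 16 * x\<^sup>2 * exp (- (x powr (1/3))) \<le> 1 \<and>
      halving_bound x \<le> 2 / 3 * x \<and> 1 \<le> potential x \<and> 2 * potential (halving_bound x) \<le> potential x"
    using eventually_halving_conditions unfolding eventually_at_top_linorder by blast
  have x1_1: "x1 \<ge> 1" using x1[of x1] by simp
  \<comment> \<open>The quadratic cost at \<open>2 * x1\<close>; it covers the base range because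
    \<open>potential x \<ge> 1\<close> there.\<close>
  define K where "K = 5 * ((2 * x1)\<^sup>2 + 2 * x1 + 1)"
  have K: "K > 0" using x1_1 by (simp add: K_def add_pos_pos)
  \<comment> \<open>\<open>n\<close> bounds the number of halvings: each one shrinks
    \<open>x\<close> by a factor of at most 2/3.\<close>
  have main: "separable E (A \<times> B) (\<lambda>v. K * potential x * (of_bool (v \<in> A) + of_bool (v \<in> B)))"
    if "finite A" "finite B" "x1 \<le> x" "bidegree_le E A B x" "x \<le> 2 * x1 * (3/2) ^ n"
    for E and A B :: "'a set" and x n
    using that
  proof (induction n arbitrary: A B x)
    have base: "separable E (A \<times> B) (\<lambda>v. K * potential x * (of_bool (v \<in> A) + of_bool (v \<in> B)))"
      if "finite A" "finite B" "x1 \<le> x" "bidegree_le E A B x" "x \<le> 2 * x1" for A B :: "'a set" and x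
    proof (rule separable_mono[OF separable_bounded_degree[OF that(1,2,4)]])
      have "x\<^sup>2 \<le> (2 * x1)\<^sup>2" using that x1_1 by (intro power_mono) auto
      then have "5 * (x\<^sup>2 + x + 1) \<le> K * 1" using that(5) by (simp add: K_def)
      also have "\<dots> \<le> K * potential x" using x1[OF that(3)] K by (intro mult_left_mono) auto
      finally show "5 * (x\<^sup>2 + x + 1) * (of_bool (v \<in> A) + of_bool (v \<in> B))
         \<le> K * potential x * (of_bool (v \<in> A) + of_bool (v \<in> B))" for v
        by (rule mult_right_mono) simp
    qed simp
    {
      case 0
      then show ?case using base by simp
    next
      case (Suc n)
      show ?case
      proof (cases "x \<le> 2 * x1")
        case True
        then show ?thesis using base Suc.prems by simp
      next
        case False
        have x: "1 \<le> x" "16 * x\<^sup>2 * exp (- (x powr (1/3))) \<le> 1" "halving_bound x \<le> 2 / 3 * x"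
          "2 * potential (halving_bound x) \<le> potential x" using x1[OF Suc.prems(3)] by auto
        \<comment> \<open>As \<open>x > 2 * x1\<close>, one halving does not leave the range in
          which the asymptotic conditions hold.\<close>
        have "x1 \<le> halving_bound x" using False x by (simp add: halving_bound_def add_increasing2)
        moreover have "halving_bound x \<le> 2 * x1 * (3/2) ^ n" using x(3) Suc.prems(5) by simp
        ultimately have "separable E (A \<times> B)
            (\<lambda>v. 2 * (K * potential (halving_bound x)) * (of_bool (v \<in> A) + of_bool (v \<in> B)))"
          by (intro separable_halving[OF Suc.prems(1,2,4) x(1,2)] Suc.IH)
        then show ?thesis
        proof (rule separable_mono)
          have "2 * (K * potential (halving_bound x)) \<le> K * potential x"
            using mult_left_mono[OF x(4), of K] K by simp
          then show "2 * (K * potential (halving_bound x)) * (of_bool (v \<in> A) + of_bool (v \<in> B))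
             \<le> K * potential x * (of_bool (v \<in> A) + of_bool (v \<in> B))" for v
            by (rule mult_right_mono) simp
        qed simp
      qed
    }
  qed
  show ?thesis
  proof (rule that[OF K x1_1])
    fix E and A B :: "'a set" and x
    assume A: "finite A" "finite B" "x1 \<le> x" "bidegree_le E A B x"
    obtain n where "x / (2 * x1) < (3/2) ^ n" using real_arch_pow[of "3/2"] by auto
    then have "x \<le> 2 * x1 * (3/2) ^ n" using x1_1 by (simp add: field_simps)
    from main[OF A this] show "separable E (A \<times> B) (\<lambda>v. K * x * (of_bool (v \<in> A) + of_bool (v \<in> B)))"
    proof (rule separable_mono)
      have "K * potential x \<le> K * x" using K by (intro mult_left_mono) (auto simp: potential_def)
      then show "K * potential x * (of_bool (v \<in> A) + of_bool (v \<in> B))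
         \<le> K * x * (of_bool (v \<in> A) + of_bool (v \<in> B))" for v by (rule mult_right_mono) simp
    qed simp
  qed
qed

section \<open>From separations to box representations\<close>

lemma lbox_le_separable:
  assumes sep: "separable E (V \<times> V) (\<lambda>_. t)" and E: "\<forall>e\<in>E. card e = 2" and t: "0 \<le> t"
  shows "real (lbox V E) \<le> t"
proof -
  obtain Is where Is': "\<forall>I\<in>set Is. interval_supergraph E I"
    "\<forall>(u, v)\<in>V \<times> V. u \<noteq> v \<longrightarrow> {u, v} \<notin> E \<longrightarrow> (\<exists>I\<in>set Is. I u \<inter> I v = {})"
    "\<forall>v. real (length (filter (\<lambda>I. bounded (I v)) Is)) \<le> t"
    using sep unfolding separable_def by (elim exE conjE)
  then have Is: "\<And>I. I \<in> set Is \<Longrightarrow> interval_supergraph E I"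
    "\<And>u v. u \<in> V \<Longrightarrow> v \<in> V \<Longrightarrow> u \<noteq> v \<Longrightarrow> {u, v} \<notin> E \<Longrightarrow> \<exists>I\<in>set Is. I u \<inter> I v = {}"
    "\<And>v. real (length (filter (\<lambda>I. bounded (I v)) Is)) \<le> t"
    by auto
  define d where "d = nat \<lfloor>t\<rfloor>"
  \<comment> \<open>\<open>local_box\<close> demands \<open>1 \<le> d'\<close> and
    \<open>d \<le> d'\<close>; the appended trivial dimensions ensure both without any bounded
    interval.\<close>
  define Js where "Js = Is @ replicate (Suc d) (\<lambda>_. UNIV)"
  define d' where "d' = length Js"
  define I where "I v i = (Js ! (i - 1)) v" for v i
  have Js: "interval_supergraph E J" if "J \<in> set Js" for J
    using that Is(1) by (auto simp: Js_def interval_supergraph_def)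
  have mem: "Js ! (i - 1) \<in> set Js" if "i \<in> {1..d'}" for i
    using that by (auto simp: d'_def)
  have int: "real_interval (I v i)" if "i \<in> {1..d'}" for v i
    using Js[OF mem[OF that]] by (auto simp: I_def interval_supergraph_def)
  define B where "B v = (\<Pi>\<^sub>E i\<in>{1..d'}. I v i)" for v
  have "local_box d d' (B v)" for v
  proof -
    have "{i \<in> {1..d'}. bounded (I v i)} = Suc ` {i. i < length Js \<and> bounded ((Js ! i) v)}"
    proof (intro equalityI subsetI)
      fix i assume "i \<in> {i \<in> {1..d'}. bounded (I v i)}"
      then show "i \<in> Suc ` {i. i < length Js \<and> bounded ((Js ! i) v)}"
        by (intro image_eqI[of i Suc "i - 1"]) (auto simp: I_def d'_def)
    qed (auto simp: I_def d'_def)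
    then have "card {i \<in> {1..d'}. bounded (I v i)} = length (filter (\<lambda>J. bounded (J v)) Js)"
      by (simp add: card_image length_filter_conv_card)
    also have "\<dots> = length (filter (\<lambda>J. bounded (J v)) Is)"
      by (simp add: Js_def not_bounded_UNIV)
    also have "\<dots> \<le> d" using Is(3)[of v] by (simp add: d_def le_nat_floor)
    finally have "card {i \<in> {1..d'}. bounded (I v i)} \<le> d" .
    moreover have "1 \<le> d'" "d \<le> d'" by (auto simp: d'_def Js_def)
    ultimately show ?thesis unfolding local_box_def B_def using int by blast
  qed
  moreover have "{u, v} \<in> E \<longleftrightarrow> B u \<inter> B v \<noteq> {}" if uv: "u \<in> V" "v \<in> V" "u \<noteq> v" for u v
  proof -
    have "B u \<inter> B v = {} \<longleftrightarrow> (\<exists>i\<in>{1..d'}. I u i \<inter> I v i = {})"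
      by (simp add: B_def PiE_Int PiE_eq_empty_iff)
    also have "\<dots> \<longleftrightarrow> {u, v} \<notin> E"
    proof
      assume "\<exists>i\<in>{1..d'}. I u i \<inter> I v i = {}"
      then obtain i where i: "i \<in> {1..d'}" "I u i \<inter> I v i = {}" by blast
      from Js[OF mem[OF i(1)]] show "{u, v} \<notin> E"
        using uv(3) i(2) unfolding I_def interval_supergraph_def by blast
    next
      assume "{u, v} \<notin> E"
      with Is(2)[OF uv] obtain J where "J \<in> set Is" "J u \<inter> J v = {}" by blast
      then have "J \<in> set Js" by (simp add: Js_def)
      with \<open>J u \<inter> J v = {}\<close> obtain i where "i < length Js" "(Js ! i) u \<inter> (Js ! i) v = {}" by (metis in_set_conv_nth)
      then show "\<exists>i\<in>{1..d'}. I u i \<inter> I v i = {}"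
        by (intro bexI[of _ "Suc i"]) (auto simp: I_def d'_def)
    qed
    finally show ?thesis by blast
  qed
  ultimately have "local_box_rep d d' V E B" by (auto simp: local_box_rep_def)
  then have "lbox V E \<le> d" by (rule lbox_le)
  then show ?thesis using t by (simp add: d_def le_nat_iff le_floor_iff)
qed

lemma card_nbrs_le_max_degree:
  assumes G: "simple_graph V E" and v: "v \<in> V"
  shows "card (nbrs E V v) \<le> max_degree V E"
proof -
  have fin: "finite V" "finite E" using G finite_subset[of E "Pow V"] by (auto simp: simple_graph_def)
  have "inj_on (\<lambda>u. {u, v}) (nbrs E V v)" by (auto simp: inj_on_def doubleton_eq_iff)
  then have "card (nbrs E V v) = card ((\<lambda>u. {u, v}) ` nbrs E V v)" by (simp add: card_image)
  also have "\<dots> \<le> degree E v" unfolding degree_def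
    by (rule card_mono) (use fin in \<open>auto simp: nbrs_def\<close>)
  also have "\<dots> \<le> max_degree V E" unfolding max_degree_def using fin v by (intro Max_ge) auto
  finally show ?thesis .
qed

theorem lbox_linear_upper_bound:
  "\<exists>C > 0. \<forall>(V :: 'a set) E. simple_graph V E \<and> max_degree V E \<ge> 1 \<longrightarrow>
     real (lbox V E) \<le> C * real (max_degree V E)"
proof -
  obtain K x1 :: real where K: "K > 0" "x1 \<ge> 1" and
    sep: "\<And>E (A :: 'a set) B x. finite A \<Longrightarrow> finite B \<Longrightarrow> x1 \<le> x \<Longrightarrow> bidegree_le E A B x \<Longrightarrow>
        separable E (A \<times> B) (\<lambda>v. K * x * (of_bool (v \<in> A) + of_bool (v \<in> B)))"
    using separable_linear by blast
  show ?thesis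
  proof (intro exI[of _ "2 * K * x1"] conjI allI impI)
    fix V :: "'a set" and E assume G: "simple_graph V E \<and> 1 \<le> max_degree V E"
    \<comment> \<open>Scaling by \<open>x1\<close> puts the degree bound into the range of the
      linear estimate, because the maximum degree is at least 1.\<close>
    define x where "x = x1 * real (max_degree V E)"
    have x: "x1 \<le> x" "real (max_degree V E) \<le> x" using G K by (auto simp: x_def)
    have "separable E (V \<times> V) (\<lambda>v. K * x * (of_bool (v \<in> V) + of_bool (v \<in> V)))"
    proof (rule sep[OF _ _ x(1)])
      show "bidegree_le E V V x"
        using card_nbrs_le_max_degree[of V E] G x(2) unfolding bidegree_le_def
        by (meson of_nat_mono order_trans)
    qed (use G in \<open>auto simp: simple_graph_def\<close>)
    then have "separable E (V \<times> V) (\<lambda>_. 2 * K * x)"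
      by (rule separable_mono) (use K x in auto)
    then have "real (lbox V E) \<le> 2 * K * x"
      by (rule lbox_le_separable) (use G K x in \<open>auto simp: simple_graph_def\<close>)
    then show "real (lbox V E) \<le> 2 * K * x1 * real (max_degree V E)"
      by (simp add: x_def mult.assoc)
  qed (use K in auto)
qed

section \<open>Counting graphs of small local boxicity\<close>

definition precedes :: "real set \<Rightarrow> real set \<Rightarrow> bool" where
  "precedes S T \<longleftrightarrow> (\<forall>x\<in>S. \<forall>y\<in>T. x < y)"

lemma disjoint_intervals_iff_precedes:
  assumes "is_interval S" "is_interval T" "S \<noteq> {}" "T \<noteq> {}"
  shows "S \<inter> T = {} \<longleftrightarrow> precedes S T \<or> precedes T S"
proof
  assume dis: "S \<inter> T = {}"
  show "precedes S T \<or> precedes T S"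
  proof (rule ccontr)
    assume "\<not> ?thesis"
    then obtain x y x' y' where *: "x \<in> S" "y \<in> T" "y \<le> x" "x' \<in> S" "y' \<in> T" "x' \<le> y'"
      unfolding precedes_def by (meson not_less)
    show False
    proof (cases "x' \<le> y")
      case True
      then have "y \<in> S" using mem_is_interval_1_I[OF assms(1), of x' x y] * by auto
      then show ?thesis using dis * by auto
    next
      case False
      then have "x' \<in> T" using mem_is_interval_1_I[OF assms(2), of y y' x'] * by auto
      then show ?thesis using dis * by auto
    qed
  qed
qed (auto simp: precedes_def)

text \<open>In an interval order the sets of predecessors form a chain, so each of them is
  determined by its size \<open>a v\<close>; \<open>r u\<close> is the size of the smallest one containing \<open>u\<close>.\<close>

lemma interval_order_ranks:
  fixes I :: "nat \<Rightarrow> real set"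
  assumes D: "D \<subseteq> {..<n}" and ne: "\<And>v. v \<in> D \<Longrightarrow> I v \<noteq> {}"
  shows "\<exists>a r :: nat \<Rightarrow> nat. (\<forall>v\<in>D. a v \<le> n \<and> 1 \<le> r v \<and> r v \<le> n + 1) \<and>
           (\<forall>u\<in>D. \<forall>v\<in>D. precedes (I u) (I v) \<longleftrightarrow> r u \<le> a v)"
proof -
  define P where "P v = {u \<in> D. precedes (I u) (I v)}" for v
  define a where "a v = card (P v)" for v
  \<comment> \<open>The extra element \<open>n + 1\<close> exceeds every \<open>a v\<close>, so it
    serves as the rank of an interval that precedes no other.\<close>
  define S where "S u = insert (n + 1) (a ` {v \<in> D. u \<in> P v})" for u
  define r where "r u = Min (S u)" for u
  have fD: "finite D" using D finite_subset by blast
  then have fP: "finite (P v)" for v by (auto simp: P_def)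
  have fS: "finite (S u)" "S u \<noteq> {}" for u using fD by (auto simp: S_def)
  have an: "a v \<le> n" for v
    unfolding a_def using card_mono[of "{..<n}" "P v"] D by (auto simp: P_def)
  \<comment> \<open>Interval orders contain no 2+2: if \<open>w\<close> precedes only
    \<open>v\<close> and \<open>w'\<close> precedes only \<open>v'\<close>, then everything in
    \<open>I w'\<close> lies below \<open>y \<le> x\<close>, which lies below everything in
    \<open>I v\<close>.\<close>
  have chain: "P v \<subseteq> P v' \<or> P v' \<subseteq> P v" if v: "v \<in> D" "v' \<in> D" for v v'
  proof (rule ccontr)
    assume "\<not> ?thesis"
    then obtain w w' where w: "w \<in> D" "precedes (I w) (I v)" "\<not> precedes (I w) (I v')"
      "w' \<in> D" "precedes (I w') (I v')" "\<not> precedes (I w') (I v)"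
      by (auto simp: P_def)
    then obtain x y where xy: "x \<in> I w" "y \<in> I v'" "y \<le> x" by (auto simp: precedes_def not_less)
    have "z < t" if "z \<in> I w'" "t \<in> I v" for z t
    proof -
      have "z < y" "x < t" using w xy that by (auto simp: precedes_def)
      then show ?thesis using xy by linarith
    qed
    then show False using w by (auto simp: precedes_def)
  qed
  have "1 \<le> s" if "s \<in> S u" for u s
  proof -
    have "1 \<le> a v" if "u \<in> P v" for v
      using that fP[of v] unfolding a_def by (metis One_nat_def Suc_leI card_gt_0_iff empty_iff)
    then show ?thesis using that by (auto simp: S_def)
  qed
  then have r1: "1 \<le> r u" for u unfolding r_def using Min_in[OF fS] by blast
  have rn: "r u \<le> n + 1" for u unfolding r_def by (rule Min_le) (use fS in \<open>auto simp: S_def\<close>)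
  have "precedes (I u) (I v) \<longleftrightarrow> r u \<le> a v" if uv: "u \<in> D" "v \<in> D" for u v
  proof
    assume "precedes (I u) (I v)"
    then have "a v \<in> S u" using uv by (auto simp: S_def P_def)
    then show "r u \<le> a v" unfolding r_def using fS by auto
  next
    assume le: "r u \<le> a v"
    then have "r u \<noteq> n + 1" using an[of v] by linarith
    moreover have "r u \<in> S u" unfolding r_def using fS by simp
    ultimately obtain v' where v': "v' \<in> D" "u \<in> P v'" "r u = a v'" by (auto simp: S_def)
    have "P v' \<subseteq> P v"
      using chain[OF uv(2) v'(1)] card_seteq[OF fP, of "P v" v'] le v'(3) by (auto simp: a_def)
    then show "precedes (I u) (I v)" using v'(2) by (auto simp: P_def)
  qed
  then show ?thesis using an r1 rn by blast
qed

text \<open>\<open>F (v, j)\<close> encodes the \<open>j\<close>-th bounded interval of \<open>v\<close> as (dimension, \<open>a\<close>, \<open>r\<close>). Unused places hold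
  \<open>(0, 0, n + 1)\<close>, which is disjoint from nothing because always \<open>a \<le> n\<close> and \<open>r \<ge> 1\<close>.\<close>

definition separated_codes :: "nat \<Rightarrow> (nat \<times> nat \<Rightarrow> nat \<times> nat \<times> nat) \<Rightarrow> nat \<Rightarrow> nat \<Rightarrow> bool" where
  "separated_codes d F u v \<longleftrightarrow> (\<exists>j<d. \<exists>k<d. fst (F (u, j)) = fst (F (v, k)) \<and>
     (snd (snd (F (u, j))) \<le> fst (snd (F (v, k))) \<or> snd (snd (F (v, k))) \<le> fst (snd (F (u, j)))))"

definition decode :: "nat \<Rightarrow> nat \<Rightarrow> (nat \<times> nat \<Rightarrow> nat \<times> nat \<times> nat) \<Rightarrow> nat set set" where
  "decode n d F = {{u, v} | u v. u < n \<and> v < n \<and> u \<noteq> v \<and> \<not> separated_codes d F u v}"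

definition codes :: "nat \<Rightarrow> nat \<Rightarrow> (nat \<times> nat \<Rightarrow> nat \<times> nat \<times> nat) set" where
  "codes n d = ({..<n} \<times> {..<d} \<rightarrow>\<^sub>E {..<n * d} \<times> {..n} \<times> {..n + 1})"

text \<open>\<open>local_box\<close> itself is not monotone in \<open>d\<close>, since
  \<open>d \<le> d'\<close> may fail for the larger value; the intervals survive.\<close>

lemma local_box_intervals:
  assumes "local_box d0 d' B" "d0 \<le> d"
  shows "\<exists>I. (\<forall>i\<in>{1..d'}. real_interval (I i)) \<and> B = (\<Pi>\<^sub>E i\<in>{1..d'}. I i) \<and>
    card {i \<in> {1..d'}. bounded (I i)} \<le> d"
proof -
  obtain I where "\<forall>i\<in>{1..d'}. real_interval (I i)" "B = (\<Pi>\<^sub>E i\<in>{1..d'}. I i)"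
    "card {i \<in> {1..d'}. bounded (I i)} \<le> d0"
    using assms(1) unfolding local_box_def by (elim exE conjE)
  with assms(2) show ?thesis by (intro exI[of _ I]) simp
qed

text \<open>\<open>UNIV\<close> meets every interval, so non-adjacency is decided in dimensions
  where both intervals are bounded, and there by their order alone, which the ranks record.\<close>

lemma local_box_rep_decode:
  assumes G: "simple_graph {..<n} E" and rep: "local_box_rep d0 d' {..<n} E B" and d: "d0 \<le> d"
  shows "E \<in> decode n d ` codes n d"
proof -
  have "\<forall>v\<in>{..<n}. \<exists>I. (\<forall>i\<in>{1..d'}. real_interval (I i)) \<and> B v = (\<Pi>\<^sub>E i\<in>{1..d'}. I i) \<and>
      card {i \<in> {1..d'}. bounded (I i)} \<le> d"
  proof
    fix v assume "v \<in> {..<n}"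
    then have "local_box d0 d' (B v)" using rep by (simp add: local_box_rep_def)
    from local_box_intervals[OF this d] show "\<exists>I. (\<forall>i\<in>{1..d'}. real_interval (I i)) \<and> B v = (\<Pi>\<^sub>E i\<in>{1..d'}. I i) \<and>
      card {i \<in> {1..d'}. bounded (I i)} \<le> d" .
  qed
  from bchoice[OF this] obtain I where "\<forall>v\<in>{..<n}. (\<forall>i\<in>{1..d'}. real_interval (I v i)) \<and>
      B v = (\<Pi>\<^sub>E i\<in>{1..d'}. I v i) \<and> card {i \<in> {1..d'}. bounded (I v i)} \<le> d" ..
  then have I: "\<And>v i. v < n \<Longrightarrow> i \<in> {1..d'} \<Longrightarrow> real_interval (I v i)"
    "\<And>v. v < n \<Longrightarrow> B v = (\<Pi>\<^sub>E i\<in>{1..d'}. I v i)"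
    "\<And>v. v < n \<Longrightarrow> card {i \<in> {1..d'}. bounded (I v i)} \<le> d" by auto
  define K where "K v = {i \<in> {1..d'}. bounded (I v i)}" for v
  have fK: "finite (K v)" for v by (simp add: K_def)
  have cK: "card (K v) \<le> d" if "v < n" for v using I(3)[OF that] by (simp add: K_def)
  have nonadj: "{u, v} \<notin> E \<longleftrightarrow> (\<exists>i\<in>K u \<inter> K v. precedes (I u i) (I v i) \<or> precedes (I v i) (I u i))"
    if uv: "u < n" "v < n" "u \<noteq> v" for u v
  proof -
    have "{u, v} \<notin> E \<longleftrightarrow> B u \<inter> B v = {}" using rep uv unfolding local_box_rep_def by blast
    also have "\<dots> \<longleftrightarrow> (\<exists>i\<in>{1..d'}. I u i \<inter> I v i = {})"
      using uv by (simp add: I(2) PiE_Int PiE_eq_empty_iff)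
    also have "\<dots> \<longleftrightarrow> (\<exists>i\<in>K u \<inter> K v. I u i \<inter> I v i = {})"
    proof -
      have "i \<in> K u \<inter> K v" if "i \<in> {1..d'}" "I u i \<inter> I v i = {}" for i
        using I(1)[OF uv(1) that(1)] I(1)[OF uv(2) that(1)] that by (auto simp: K_def real_interval_def)
      then show ?thesis by (auto simp: K_def)
    qed
    also have "\<dots> \<longleftrightarrow> (\<exists>i\<in>K u \<inter> K v. precedes (I u i) (I v i) \<or> precedes (I v i) (I u i))"
    proof (rule bex_cong[OF refl])
      fix i assume "i \<in> K u \<inter> K v"
      then have "real_interval (I u i)" "real_interval (I v i)" using I(1) uv by (auto simp: K_def)
      then show "I u i \<inter> I v i = {} \<longleftrightarrow> precedes (I u i) (I v i) \<or> precedes (I v i) (I u i)"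
        unfolding real_interval_def by (intro disjoint_intervals_iff_precedes) auto
    qed
    finally show ?thesis .
  qed
  have "\<forall>v. \<exists>g. bij_betw g {0..<card (K v)} (K v)" using ex_bij_betw_nat_finite[OF fK] by simp
  from choice[OF this] obtain e where e: "\<And>v. bij_betw (e v) {0..<card (K v)} (K v)" by auto
  have eK: "e v j \<in> K v" if "j < card (K v)" for v j using bij_betwE[OF e] that by auto
  \<comment> \<open>\<open>d'\<close> is arbitrarily large, but at most \<open>n * d\<close>
    dimensions contain a bounded interval at all; \<open>g\<close> renames these.\<close>
  have "card (\<Union>v<n. K v) \<le> (\<Sum>v<n. card (K v))" by (rule card_UN_le) simp
  also have "\<dots> \<le> (\<Sum>v<n. d)" by (rule sum_mono) (use cK in auto)
  finally have "card (\<Union>v<n. K v) \<le> card {..<n * d}" by simp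
  then obtain g where g: "g ` (\<Union>v<n. K v) \<subseteq> {..<n * d}" "inj_on g (\<Union>v<n. K v)"
    using card_le_inj[of "\<Union>v<n. K v" "{..<n * d}"] fK by auto
  define Q where "Q i a r \<longleftrightarrow> (\<forall>v\<in>{v. v < n \<and> i \<in> K v}. a v \<le> n \<and> 1 \<le> r v \<and> r v \<le> n + 1) \<and>
           (\<forall>u\<in>{v. v < n \<and> i \<in> K v}. \<forall>v\<in>{v. v < n \<and> i \<in> K v}.
              precedes (I u i) (I v i) \<longleftrightarrow> r u \<le> a v)" for i and a r :: "nat \<Rightarrow> nat"
  have "\<forall>i. \<exists>a r. Q i a r"
    unfolding Q_def
    using I(1) by (intro allI interval_order_ranks) (auto simp: K_def real_interval_def)
  from choice[OF this] obtain a where "\<forall>i. \<exists>r. Q i (a i) r" ..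
  from choice[OF this] obtain r where "\<forall>i. Q i (a i) (r i)" ..
  then have ar: "\<And>i v. v < n \<Longrightarrow> i \<in> K v \<Longrightarrow> a i v \<le> n \<and> 1 \<le> r i v \<and> r i v \<le> n + 1"
    "\<And>i u v. u < n \<Longrightarrow> v < n \<Longrightarrow> i \<in> K u \<Longrightarrow> i \<in> K v \<Longrightarrow> precedes (I u i) (I v i) \<longleftrightarrow> r i u \<le> a i v"
    by (auto simp: Q_def)
  define F where "F = (\<lambda>(v, j)\<in>{..<n} \<times> {..<d}.
    if j < card (K v) then (g (e v j), a (e v j) v, r (e v j) v) else (0, 0, n + 1))"
  have F: "F \<in> codes n d"
    unfolding codes_def F_def
  proof (rule PiE_I)
    fix x assume "x \<in> {..<n} \<times> {..<d}"
    then obtain v j where x: "x = (v, j)" "v < n" "j < d" by auto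
    then have "0 < n * d" by auto
    moreover have "g (e v j) < n * d" if "j < card (K v)" using g(1) eK[OF that] x by blast
    ultimately show "(\<lambda>(v, j)\<in>{..<n} \<times> {..<d}.
        if j < card (K v) then (g (e v j), a (e v j) v, r (e v j) v) else (0, 0, n + 1)) x
       \<in> {..<n * d} \<times> {..n} \<times> {..n + 1}"
      using ar(1)[of v "e v j"] eK[of j v] x by auto
  qed simp
  have sep: "separated_codes d F u v \<longleftrightarrow>
      (\<exists>i\<in>K u \<inter> K v. precedes (I u i) (I v i) \<or> precedes (I v i) (I u i))"
    if uv: "u < n" "v < n" for u v
  proof
    assume "separated_codes d F u v"
    then obtain j k where jk: "j < d" "k < d" "fst (F (u, j)) = fst (F (v, k))"
      "snd (snd (F (u, j))) \<le> fst (snd (F (v, k))) \<or> snd (snd (F (v, k))) \<le> fst (snd (F (u, j)))"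
      by (auto simp: separated_codes_def)
    have Fw: "F (w, l) = (if l < card (K w) then (g (e w l), a (e w l) w, r (e w l) w) else (0, 0, n + 1))"
      if "w < n" "l < d" for w l using that by (simp add: F_def)
    have bd: "1 \<le> snd (snd (F (w, l)))" "fst (snd (F (w, l))) \<le> n" if "w < n" "l < d" for w l
      using ar(1)[of w "e w l"] eK[of l w] that by (auto simp: Fw)
    have j: "j < card (K u)" 
      using jk(4) bd[OF uv(2) jk(2)] uv jk by (auto simp: Fw[OF uv(1) jk(1)] split: if_splits)
    have k: "k < card (K v)"
      using jk(4) bd[OF uv(1) jk(1)] uv jk by (auto simp: Fw[OF uv(2) jk(2)] split: if_splits)
    have "g (e u j) = g (e v k)" using jk(3) j k by (simp add: Fw uv jk)
    then have i: "e u j = e v k" using g(2) eK[OF j] eK[OF k] uv by (auto simp: inj_on_def)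
    then have "e u j \<in> K u \<inter> K v" using eK[OF j] eK[OF k] by simp
    moreover have "r (e u j) u \<le> a (e u j) v \<or> r (e u j) v \<le> a (e u j) u"
      using jk(4) j k i by (simp add: Fw uv jk)
    ultimately show "\<exists>i\<in>K u \<inter> K v. precedes (I u i) (I v i) \<or> precedes (I v i) (I u i)"
      using ar(2) uv by blast
  next
    assume "\<exists>i\<in>K u \<inter> K v. precedes (I u i) (I v i) \<or> precedes (I v i) (I u i)"
    then obtain i where i: "i \<in> K u" "i \<in> K v" "precedes (I u i) (I v i) \<or> precedes (I v i) (I u i)" by blast
    have "\<exists>l<card (K w). e w l = i" if "i \<in> K w" for w
      using bij_betw_imp_surj_on[OF e[of w]] that by (metis atLeastLessThan_iff imageE)
    then obtain j k where jk: "j < card (K u)" "e u j = i" "k < card (K v)" "e v k = i" using i by meson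
    then have jkd: "j < d" "k < d" using cK uv by (meson less_le_trans)+
    show "separated_codes d F u v" unfolding separated_codes_def
      using jk jkd uv i(3) ar(2)[OF uv i(1,2)] ar(2)[OF uv(2,1) i(2,1)]
      by (intro exI[of _ j] exI[of _ k] conjI) (auto simp: F_def)
  qed
  have "E = decode n d F"
  proof (intro equalityI subsetI)
    fix x assume x: "x \<in> E"
    then have "x \<subseteq> {..<n}" "card x = 2" using G by (auto simp: simple_graph_def)
    then obtain u v where uv: "x = {u, v}" "u \<noteq> v" "u < n" "v < n" by (auto simp: card_2_iff)
    then have "\<not> separated_codes d F u v" using nonadj[of u v] sep[of u v] x by simp
    then show "x \<in> decode n d F" using uv by (auto simp: decode_def)
  next
    fix x assume "x \<in> decode n d F"
    then obtain u v where uv: "x = {u, v}" "u \<noteq> v" "u < n" "v < n" "\<not> separated_codes d F u v"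
      by (auto simp: decode_def)
    then show "x \<in> E" using nonadj[of u v] sep[of u v] by auto
  qed
  then show ?thesis using F by blast
qed

text \<open>From \<open>n + 1 \<le> 2 * n\<close> and \<open>n + 2 \<le> 3 * n\<close> there are at
  most \<open>6 * d * n ^ 3\<close> codes per interval; the hypothesis turns this into
  \<open>n ^ 4\<close>.\<close>

lemma card_lbox_le:
  assumes n: "6 * d \<le> n"
  shows "card {E. simple_graph {..<n} E \<and> lbox {..<n} E \<le> d} \<le> n ^ (4 * n * d)"
proof -
  have fin: "finite (codes n d)" unfolding codes_def by (intro finite_PiE) auto
  have "{E. simple_graph {..<n} E \<and> lbox {..<n} E \<le> d} \<subseteq> decode n d ` codes n d"
    using local_box_rep_decode lbox_attained by (smt (verit) mem_Collect_eq subsetI)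
  then have "card {E. simple_graph {..<n} E \<and> lbox {..<n} E \<le> d} \<le> card (decode n d ` codes n d)"
    by (rule card_mono[rotated]) (use fin in simp)
  also have "\<dots> \<le> card (codes n d)" by (rule card_image_le[OF fin])
  also have "\<dots> = (n * d * ((n + 1) * (n + 2))) ^ (n * d)"
    unfolding codes_def by (simp add: card_PiE card_cartesian_product)
  also have "\<dots> \<le> (n ^ 4) ^ (n * d)"
  proof (cases "d = 0")
    case False
    then have "n * d * ((n + 1) * (n + 2)) \<le> n * d * ((2 * n) * (3 * n))"
      using n by (intro mult_le_mono) auto
    also have "\<dots> = (6 * d) * n ^ 3" by (simp add: power3_eq_cube)
    also have "\<dots> \<le> n * n ^ 3" using n by (rule mult_le_mono1)
    also have "\<dots> = n ^ 4" by (simp add: numeral_eq_Suc)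
    finally show ?thesis by (rule power_mono) simp
  qed simp
  also have "\<dots> = n ^ (4 * n * d)" by (simp add: mult.assoc flip: power_mult)
  finally show ?thesis .
qed

section \<open>Counting graphs of given maximum degree\<close>

text \<open>\<open>2 * D\<close> blocks of \<open>m\<close> vertices, \<open>D\<close> on each side, and a perfect matching \<open>\<sigma> (i, j)\<close> between the
  \<open>i\<close>-th block on the left and the \<open>j\<close>-th block on the right.\<close>

definition block_graph :: "nat \<Rightarrow> nat \<Rightarrow> (nat \<times> nat \<Rightarrow> nat \<Rightarrow> nat) \<Rightarrow> nat set set" where
  "block_graph D m \<sigma> = {{m * i + x, m * D + (m * j + \<sigma> (i, j) x)} | i j x. i < D \<and> j < D \<and> x < m}"

definition matchings :: "nat \<Rightarrow> nat \<Rightarrow> (nat \<times> nat \<Rightarrow> nat \<Rightarrow> nat) set" where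
  "matchings D m = ({..<D} \<times> {..<D} \<rightarrow>\<^sub>E {p. p permutes {..<m}})"

lemma card_matchings: "card (matchings D m) = fact m ^ (D * D)"
  unfolding matchings_def by (simp add: card_PiE card_permutations[of "{..<m}" m] card_cartesian_product)

lemma block_lt: "m * i + x < m * D" if "i < D" "x < (m::nat)"
proof -
  have "m * i + x < m * Suc i" using that by simp
  also have "\<dots> \<le> m * D" using that by (intro mult_le_mono2) simp
  finally show ?thesis .
qed

lemma block_eq_iff: "m * i + x = m * i' + x' \<longleftrightarrow> i = i' \<and> x = x'" if "x < m" "x' < (m::nat)"
proof
  assume eq: "m * i + x = m * i' + x'"
  have "i = (m * i + x) div m" "i' = (m * i' + x') div m" using that by auto
  then have "i = i'" using eq by simp
  then show "i = i' \<and> x = x'" using eq by simp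
qed simp

lemma matchings_less:
  assumes "\<sigma> \<in> matchings D m" "i < D" "j < D"
  shows "\<sigma> (i, j) permutes {..<m}" "x < m \<Longrightarrow> \<sigma> (i, j) x < m"
proof -
  show "\<sigma> (i, j) permutes {..<m}" using assms by (auto simp: matchings_def)
  from permutes_in_image[OF this, of x] show "x < m \<Longrightarrow> \<sigma> (i, j) x < m" by simp
qed

text \<open>Left endpoints lie below \<open>m * D\<close> and right ones do not, so an edge reveals
  its orientation, both blocks and both positions. This makes the matchings recoverable.\<close>

lemma in_block_graph_iff:
  assumes "\<sigma> \<in> matchings D m" "i < D" "j < D" "x < m" "y < m"
  shows "{m * i + x, m * D + (m * j + y)} \<in> block_graph D m \<sigma> \<longleftrightarrow> \<sigma> (i, j) x = y"
proof
  assume "{m * i + x, m * D + (m * j + y)} \<in> block_graph D m \<sigma>"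
  then obtain i' j' x' where *: "i' < D" "j' < D" "x' < m"
    "{m * i + x, m * D + (m * j + y)} = {m * i' + x', m * D + (m * j' + \<sigma> (i', j') x')}"
    by (auto simp: block_graph_def)
  have "m * i + x < m * D" "m * i' + x' < m * D" using block_lt assms * by auto
  then have "m * i + x = m * i' + x'" "m * j + y = m * j' + \<sigma> (i', j') x'"
    using *(4) by (auto simp: doubleton_eq_iff)
  then show "\<sigma> (i, j) x = y"
    using block_eq_iff[of x m x' i i'] block_eq_iff[of y m "\<sigma> (i', j') x'" j j']
      matchings_less(2)[OF assms(1) *(1-3)] assms * by auto
qed (use assms in \<open>auto simp: block_graph_def\<close>)

lemma inj_on_block_graph: "inj_on (block_graph D m) (matchings D m)"
proof (rule inj_onI)
  fix \<sigma> \<tau> assume st: "\<sigma> \<in> matchings D m" "\<tau> \<in> matchings D m" "block_graph D m \<sigma> = block_graph D m \<tau>"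
  show "\<sigma> = \<tau>"
  proof (rule PiE_ext)
    show "\<sigma> \<in> ({..<D} \<times> {..<D} \<rightarrow>\<^sub>E {p. p permutes {..<m}})" "\<tau> \<in> ({..<D} \<times> {..<D} \<rightarrow>\<^sub>E {p. p permutes {..<m}})"
      using st by (auto simp: matchings_def)
    fix q assume "q \<in> {..<D} \<times> {..<D}"
    then obtain i j where q: "q = (i, j)" "i < D" "j < D" by auto
    have "\<sigma> (i, j) x = \<tau> (i, j) x" for x
    proof (cases "x < m")
      case True
      have "{m * i + x, m * D + (m * j + \<sigma> (i, j) x)} \<in> block_graph D m \<sigma>"
        using in_block_graph_iff[OF st(1) q(2,3) True] matchings_less(2)[OF st(1) q(2,3) True] by simp
      then show ?thesis
        using in_block_graph_iff[OF st(2) q(2,3) True] matchings_less(2)[OF st(1) q(2,3) True] st(3) by simp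
    next
      case False
      then show ?thesis
        using matchings_less(1)[OF st(1) q(2,3)] matchings_less(1)[OF st(2) q(2,3)]
        by (simp add: permutes_not_in)
    qed
    then show "\<sigma> q = \<tau> q" using q by auto
  qed
qed

text \<open>A vertex has at most one edge to each block of the other side; vertex 0 attains the
  degree \<open>D\<close>. Vertices from \<open>2 * (m * D)\<close> on are isolated, so
  \<open>n\<close> need not be a multiple of the block size.\<close>

lemma block_graph_labelled:
  assumes \<sigma>: "\<sigma> \<in> matchings D m" and D: "1 \<le> D" and m: "1 \<le> m" and n: "2 * (m * D) \<le> n"
  shows "block_graph D m \<sigma> \<in> labelled_graphs n (\<lambda>V E. max_degree V E = D)"
proof -
  let ?E = "block_graph D m \<sigma>"
  have simple: "simple_graph {..<n} ?E"
    unfolding simple_graph_def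
  proof (intro conjI ballI)
    fix e assume "e \<in> ?E"
    then obtain i j x where e: "i < D" "j < D" "x < m" "e = {m * i + x, m * D + (m * j + \<sigma> (i, j) x)}"
      by (auto simp: block_graph_def)
    have "m * i + x < m * D" "m * j + \<sigma> (i, j) x < m * D"
      using block_lt e matchings_less(2)[OF \<sigma> e(1-3)] by auto
    then show "e \<subseteq> {..<n}" "card e = 2" using e n by auto
  qed simp
  have fin: "finite ?E" using simple finite_subset[of ?E "Pow {..<n}"] by (auto simp: simple_graph_def)
  have le: "degree ?E v \<le> D" for v
  proof (cases "v < m * D")
    case True
    have "{e \<in> ?E. v \<in> e} \<subseteq> (\<lambda>j. {v, m * D + (m * j + \<sigma> (v div m, j) (v mod m))}) ` {..<D}"
      using True by (auto simp: block_graph_def)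
    then have "card {e \<in> ?E. v \<in> e} \<le> card {..<D}" by (rule surj_card_le[rotated]) simp
    then show ?thesis by (simp add: degree_def)
  next
    case False
    define w j where "w = v - m * D" and "j = w div m"
    have v: "v = m * D + w" using False by (simp add: w_def)
    have "{e \<in> ?E. v \<in> e} \<subseteq> (\<lambda>i. {m * i + inv (\<sigma> (i, j)) (w mod m), v}) ` {..<D}"
    proof
      fix e assume "e \<in> {e \<in> ?E. v \<in> e}"
      then obtain i j' x where e: "i < D" "j' < D" "x < m" "v \<in> e"
        "e = {m * i + x, m * D + (m * j' + \<sigma> (i, j') x)}"
        by (auto simp: block_graph_def)
      have s: "\<sigma> (i, j') x < m" using matchings_less(2)[OF \<sigma> e(1-3)] .
      have "m * i + x < m * D" using block_lt e by auto
      then have w: "w = m * j' + \<sigma> (i, j') x" using e(4,5) v by auto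
      then have "j = j'" "w mod m = \<sigma> (i, j') x" using s by (auto simp: j_def)
      then have "inv (\<sigma> (i, j)) (w mod m) = x"
        using permutes_inverses(2)[OF matchings_less(1)[OF \<sigma> e(1,2)]] by simp
      then show "e \<in> (\<lambda>i. {m * i + inv (\<sigma> (i, j)) (w mod m), v}) ` {..<D}"
        using e(1,5) w v by (intro image_eqI[of _ _ i]) auto
    qed
    then have "card {e \<in> ?E. v \<in> e} \<le> card {..<D}" by (rule surj_card_le[rotated]) simp
    then show ?thesis by (simp add: degree_def)
  qed
  have ge: "D \<le> degree ?E 0"
  proof -
    let ?f = "\<lambda>j. {0, m * D + (m * j + \<sigma> (0, j) 0)}"
    have s: "\<sigma> (0, j) 0 < m" if "j < D" for j using matchings_less(2)[OF \<sigma> _ that, of 0 0] D m by simp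
    have "inj_on ?f {..<D}"
    proof (rule inj_onI)
      fix j j' assume j: "j \<in> {..<D}" "j' \<in> {..<D}" "?f j = ?f j'"
      then have "m * j + \<sigma> (0, j) 0 = m * j' + \<sigma> (0, j') 0" using D m by (auto simp: doubleton_eq_iff)
      then show "j = j'" using block_eq_iff[OF s s] j by auto
    qed
    then have "D = card (?f ` {..<D})" by (simp add: card_image)
    also have "\<dots> \<le> card {e \<in> ?E. 0 \<in> e}"
    proof (rule card_mono)
      show "?f ` {..<D} \<subseteq> {e \<in> ?E. 0 \<in> e}"
        using D m by (force simp: block_graph_def)
    qed (use fin in simp)
    finally show ?thesis by (simp add: degree_def)
  qed
  have "0 < m * D" using D m by simp
  then have n0: "0 < n" using n by linarith
  have "max_degree {..<n} ?E = D"
    unfolding max_degree_def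
  proof (rule Max_eqI)
    show "D \<in> insert 0 (degree ?E ` {..<n})" using le[of 0] ge n0 by (intro insertI2 image_eqI[of _ _ 0]) auto
  qed (use le in auto)
  then show ?thesis using simple by (simp add: labelled_graphs_def)
qed

section \<open>Asymptotic comparison of the two counts\<close>

lemma finite_labelled_graphs: "finite (labelled_graphs n C)"
proof (rule finite_subset)
  show "labelled_graphs n C \<subseteq> Pow (Pow {..<n})" by (auto simp: labelled_graphs_def simple_graph_def)
qed simp

lemma card_labelled_graphs_ge:
  assumes "1 \<le> D" "1 \<le> m" "2 * (m * D) \<le> n"
  shows "fact m ^ (D * D) \<le> card (labelled_graphs n (\<lambda>V E. max_degree V E = D))"
proof -
  have "fact m ^ (D * D) = card (block_graph D m ` matchings D m)"
    using inj_on_block_graph by (simp add: card_image card_matchings)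
  also have "\<dots> \<le> card (labelled_graphs n (\<lambda>V E. max_degree V E = D))"
    by (rule card_mono) (use block_graph_labelled assms finite_labelled_graphs in auto)
  finally show ?thesis .
qed

text \<open>The \<open>m\<close>-th term of the series of \<open>exp m\<close> is at most the whole
  sum.\<close>

lemma fact_ge_power_exp: "(real m / exp 1) ^ m \<le> fact m"
proof -
  have "(\<Sum>k\<in>{m}. real m ^ k /\<^sub>R fact k) \<le> exp (real m)"
    unfolding exp_def by (rule sum_le_suminf[OF summable_exp_generic]) auto
  then have "real m ^ m / fact m \<le> exp 1 ^ m" by (simp add: divide_inverse mult.commute flip: exp_of_nat_mult)
  then show ?thesis by (simp add: power_divide field_simps)
qed

text \<open>For large \<open>n\<close>, \<open>m / exp 1\<close> is at least \<open>sqrt n\<close>,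
  so the count is at least \<open>n\<close> to the power \<open>m * D\<^sup>2 / 2\<close>. The 8
  combines this 2 with \<open>m \<ge> n / (4 * D)\<close>.\<close>

lemma eventually_card_labelled_graphs_ge:
  assumes D: "1 \<le> D"
  shows "eventually (\<lambda>n. real n powr (real n * real D / 8)
     \<le> real (card (labelled_graphs n (\<lambda>V E. max_degree V E = D)))) sequentially"
proof -
  have "eventually (\<lambda>n. sqrt (real n) * exp 1 \<le> real n / (4 * real D)) sequentially"
    using D by real_asymp
  moreover have "eventually (\<lambda>n. n \<ge> 4 * D) sequentially" by (rule eventually_ge_at_top)
  ultimately show ?thesis
  proof eventually_elim
    case (elim n)
    define m where "m = n div (2 * D)"
    have m1: "1 \<le> m" using elim(2) D div_le_mono[of "2 * D" n "2 * D"] by (auto simp: m_def)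
    have mn: "2 * (m * D) \<le> n" using times_div_less_eq_dividend[of "2 * D" n]
      by (simp add: m_def ac_simps)
    have m: "real n / (4 * real D) \<le> real m"
    proof -
      have "n = 2 * D * m + n mod (2 * D)" by (simp add: m_def)
      moreover have "n mod (2 * D) < 2 * D" using D by simp
      ultimately have "n < 2 * D * m + 2 * D" by linarith
      also have "2 * D * m + 2 * D \<le> 2 * D * m + 2 * D * m" using m1 by simp
      finally have "real n \<le> real (2 * D * m + 2 * D * m)" by (intro of_nat_mono) simp
      then show ?thesis using D by (simp add: field_simps)
    qed
    have n1: "1 \<le> real n" using elim(2) D by simp
    have sq: "sqrt (real n) \<le> real m / exp 1" using elim(1) m by (simp add: field_simps)
    have "real n * real D / 4 = (real n / (4 * real D)) * real D ^ 2"
      using D by (simp add: power2_eq_square)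
    also have "\<dots> \<le> real m * real D ^ 2" using m by (rule mult_right_mono) simp
    finally have "real n powr (real n * real D / 8) \<le> real n powr ((real m * real D ^ 2) / 2)"
      using n1 by (intro powr_mono) (auto simp: mult.commute)
    also have "\<dots> = sqrt (real n) powr (real m * real D ^ 2)"
      using n1 by (simp add: powr_half_sqrt[symmetric] powr_powr)
    also have "\<dots> = sqrt (real n) ^ (m * (D * D))"
      using n1 by (subst powr_realpow[symmetric]) (auto simp: power2_eq_square)
    also have "\<dots> \<le> (real m / exp 1) ^ (m * (D * D))" by (intro power_mono sq) simp
    also have "\<dots> = ((real m / exp 1) ^ m) ^ (D * D)" by (rule power_mult)
    also have "\<dots> \<le> fact m ^ (D * D)" by (intro power_mono fact_ge_power_exp) simp
    also have "\<dots> \<le> real (card (labelled_graphs n (\<lambda>V E. max_degree V E = D)))"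
      using card_labelled_graphs_ge[OF D m1 mn, THEN of_nat_mono[where ?'a = real]] by simp
    finally show ?case .
  qed
qed

text \<open>With \<open>d = D div 64\<close> the exponent \<open>4 * n * d\<close> is at most half
  of \<open>n * D / 8\<close>. The remaining half is at least 1 once \<open>n \<ge> 16\<close>, so
  the bad graphs have proportion at most \<open>1 / n\<close>.\<close>

lemma almost_all_lbox_ge:
  "almost_all (\<lambda>V E. max_degree V E = D) (\<lambda>V E. real (lbox V E) \<ge> 1 / 64 * real D)"
proof (cases "D = 0")
  case True
  \<comment> \<open>For \<open>D = 0\<close> every graph has the property, but the class must be
    nonempty because \<open>0 / 0 = 0\<close>.\<close>
  have "{} \<in> labelled_graphs n (\<lambda>V E. max_degree V E = 0)" for n
  proof -
    have "Max (insert 0 (degree {} ` {..<n})) = 0" by (rule Max_eqI) (auto simp: degree_def)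
    then show ?thesis by (simp add: labelled_graphs_def simple_graph_def max_degree_def)
  qed
  then have "card (labelled_graphs n (\<lambda>V E. max_degree V E = 0)) \<noteq> 0" for n
    using card_0_eq[OF finite_labelled_graphs] by blast
  then have "real (card (labelled_graphs n (\<lambda>V E. max_degree V E = 0))) /
      real (card (labelled_graphs n (\<lambda>V E. max_degree V E = 0))) = 1" for n
    by (simp only: divide_self of_nat_eq_0_iff not_False_eq_True)
  then show ?thesis unfolding almost_all_def True by (simp del: divide_self_if)
next
  case False
  then have D: "1 \<le> D" by simp
  define T where "T n = labelled_graphs n (\<lambda>V E. max_degree V E = D)" for n
  define good where "good n = {E \<in> T n. real (lbox {..<n} E) \<ge> 1 / 64 * real D}" for n
  define bad where "bad n = {E \<in> T n. real (lbox {..<n} E) < 1 / 64 * real D}" for n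
  define d where "d = D div 64"
  have split: "real (card (good n)) = real (card (T n)) - real (card (bad n))" for n
  proof -
    have "T n = good n \<union> bad n" "good n \<inter> bad n = {}" by (auto simp: good_def bad_def)
    moreover have "finite (good n)" "finite (bad n)"
      using finite_labelled_graphs by (auto simp: good_def bad_def T_def)
    ultimately have "card (T n) = card (good n) + card (bad n)" by (simp add: card_Un_disjoint)
    then show ?thesis by simp
  qed
  have "eventually (\<lambda>n. 1 - 1 / real n \<le> real (card (good n)) / real (card (T n))) sequentially"
    using eventually_card_labelled_graphs_ge[OF D] eventually_ge_at_top[of "16 + 6 * d"]
  proof eventually_elim
    case (elim n)
    have n: "6 * d \<le> n" "16 \<le> n" using elim(2) by auto
    have "bad n \<subseteq> {E. simple_graph {..<n} E \<and> lbox {..<n} E \<le> d}"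
      by (auto simp: bad_def T_def labelled_graphs_def d_def)
    moreover have "finite {E. simple_graph {..<n} E \<and> lbox {..<n} E \<le> d}"
      by (rule finite_subset[of _ "Pow (Pow {..<n})"]) (auto simp: simple_graph_def)
    ultimately have "card (bad n) \<le> card {E. simple_graph {..<n} E \<and> lbox {..<n} E \<le> d}"
      by (rule card_mono[rotated])
    also have "\<dots> \<le> n ^ (4 * n * d)" by (rule card_lbox_le[OF n(1)])
    finally have "real (card (bad n)) \<le> real (n ^ (4 * n * d))" by (rule of_nat_mono)
    also have "\<dots> = real n powr (real (4 * n * d))" using n by (subst powr_realpow) auto
    also have "\<dots> \<le> real n powr (real n * real D / 8 - 1)"
    proof (rule powr_mono)
      have "64 * d \<le> D" by (simp add: d_def)
      then have "real n * (64 * real d) \<le> real n * real D" by (intro mult_left_mono) linarith+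
      moreover have "16 * 1 \<le> real n * real D" using n D by (intro mult_mono) auto
      ultimately show "real (4 * n * d) \<le> real n * real D / 8 - 1" by simp
    qed (use n in auto)
    also have "\<dots> = real n powr (real n * real D / 8) / real n" using n by (simp add: powr_diff)
    also have "\<dots> \<le> real (card (T n)) / real n"
      using elim(1) by (intro divide_right_mono) (auto simp: T_def)
    finally have "real (card (bad n)) \<le> real (card (T n)) / real n" .
    moreover have "0 < real (card (T n))"
    proof -
      have "0 < real n powr (real n * real D / 8)" using n by simp
      then show ?thesis using elim(1) unfolding T_def by linarith
    qed
    ultimately show ?case unfolding split by (simp add: field_simps)
  qed
  moreover have "eventually (\<lambda>n. real (card (good n)) / real (card (T n)) \<le> 1) sequentially"
    by (rule always_eventually) (auto simp: split divide_le_eq_1)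
  moreover have "(\<lambda>n. 1 - 1 / real n) \<longlonglongrightarrow> 1" by real_asymp
  ultimately have "(\<lambda>n. real (card (good n)) / real (card (T n))) \<longlonglongrightarrow> 1"
    by (rule tendsto_sandwich) (rule tendsto_const)
  then show ?thesis unfolding almost_all_def good_def T_def .
qed

theorem theorem1p1:
  shows "\<exists>C\<^sub>1 C\<^sub>2 :: real. C\<^sub>1 > 0 \<and> C\<^sub>2 > 0 \<and>
    (\<forall>\<Delta> :: nat.
       (\<Delta> \<ge> 1 \<longrightarrow>
          (\<forall>(V :: nat set) E. simple_graph V E \<and> max_degree V E = \<Delta> \<longrightarrow>
             real (lbox V E) \<le> C\<^sub>1 * real \<Delta>)) \<and>
       almost_all (\<lambda>V E. max_degree V E = \<Delta>)
                  (\<lambda>V E. real (lbox V E) \<ge> C\<^sub>2 * real \<Delta>))"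
proof -
  from lbox_linear_upper_bound[where ?'a = nat]
  obtain C :: real where C: "C > 0" "\<forall>(V :: nat set) E. simple_graph V E \<and> max_degree V E \<ge> 1 \<longrightarrow>
     real (lbox V E) \<le> C * real (max_degree V E)"
    by (elim exE conjE)
  show ?thesis
  proof (rule exI[of _ C], rule exI[of _ "1 / 64"], intro conjI allI impI)
    fix \<Delta> :: nat and V :: "nat set" and E
    assume "1 \<le> \<Delta>" "simple_graph V E \<and> max_degree V E = \<Delta>"
    then show "real (lbox V E) \<le> C * real \<Delta>" using C(2) by auto
  qed (use C(1) almost_all_lbox_ge in simp_all)
qed

end
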